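(* $\mathbb{CP}^2$ admits a $(1,0)$-Stein trisection.
   Context: A $(g;k_1,k_2,k_3)$-Stein trisection of a complex surface $X$ is a collection of three Stein domains $Z_1,Z_2,Z_3\subset X$ such that (indices mod 3): (1) $Z_1,Z_2,Z_3$ form an open cover of $X$; (2) $Z_i$ is diffeomorphic to $\natural^{k_i}S^1\times B^3$ (a ball if $k_i=0$); (3) $Z_i\cap Z_{i+1}$ is diffeomorphic to $\natural^g S^1\times B^3$; (4) $Z_1\cap Z_2\cap Z_3$ is diffeomorphic to $\Sigma_g\times D^2$, with $\Sigma_g$ a closed oriented surface of genus $g$. Here the balls, disks and handlebodies are understood to be open. A $(g,k)$-Stein trisection is one with $k_1=k_2=k_3=k$. A paracompact complex manifold is Stein if it is holomorphically convex, global holomorphic functions separate points, and near each point there are global holomorphic functions forming local coordinates. *)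

theory Defs
  imports "HOL-Analysis.Analysis"
begin

section \<open>Smooth and holomorphic functions on Euclidean domains\<close>

text \<open>Meant for open \<open>S\<close>.\<close>

primrec C_k_on :: "nat \<Rightarrow> ('a::euclidean_space \<Rightarrow> 'b::real_normed_vector) \<Rightarrow> 'a set \<Rightarrow> bool" where
  "C_k_on 0 f S \<longleftrightarrow> continuous_on S f"
| "C_k_on (Suc k) f S \<longleftrightarrow> (\<forall>x\<in>S. f differentiable (at x)) \<and>
     (\<forall>v. C_k_on k (\<lambda>x. frechet_derivative f (at x) v) S)"

text \<open>Smoothness on an arbitrary subset of a Euclidean space: local existence of smooth extensions
  to open sets of the ambient space. For open sets this is ordinary smoothness, and for embedded
  submanifolds it is smoothness in the sense of manifolds.\<close>

definition smooth_on :: "'a::euclidean_space set \<Rightarrow> ('a \<Rightarrow> 'b::real_normed_vector) \<Rightarrow> bool" where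
  "smooth_on S f \<longleftrightarrow>
     (\<forall>x\<in>S. \<exists>W g. open W \<and> x \<in> W \<and> (\<forall>k. C_k_on k g W) \<and> (\<forall>y\<in>W \<inter> S. g y = f y))"

text \<open>Holomorphic functions of several variables, on open sets \<open>S\<close>: the real Frechet derivative
  exists and is complex linear.\<close>

definition holomorphic_fun_on :: "(complex^'n) set \<Rightarrow> (complex^'n \<Rightarrow> complex) \<Rightarrow> bool" where
  "holomorphic_fun_on S f \<longleftrightarrow>
     (\<forall>x\<in>S. \<exists>D. (f has_derivative D) (at x) \<and> (\<forall>c v. D (c *s v) = c * D v))"

definition holomorphic_map_on :: "(complex^'n) set \<Rightarrow> (complex^'n \<Rightarrow> complex^'m) \<Rightarrow> bool" where
  "holomorphic_map_on S F \<longleftrightarrow> (\<forall>j. holomorphic_fun_on S (\<lambda>x. F x $ j))"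

section \<open>Complex manifolds\<close>

text \<open>A chart is a pair \<open>(U, \<phi>)\<close>; the values of \<open>\<phi>\<close> outside \<open>U\<close> are irrelevant.\<close>

record ('p, 'm) charted_space =
  top_of :: "'p topology"
  charts :: "('p set \<times> ('p \<Rightarrow> 'm)) set"

definition is_chart :: "'p topology \<Rightarrow> 'p set \<times> ('p \<Rightarrow> 'm::euclidean_space) \<Rightarrow> bool" where
  "is_chart T = (\<lambda>(U, \<phi>). openin T U \<and> open (\<phi> ` U) \<and>
     homeomorphic_map (subtopology T U) (top_of_set (\<phi> ` U)) \<phi>)"

definition holomorphically_compatible ::
  "'p set \<times> ('p \<Rightarrow> complex^'n) \<Rightarrow> 'p set \<times> ('p \<Rightarrow> complex^'n) \<Rightarrow> bool" where
  "holomorphically_compatible = (\<lambda>(U, \<phi>) (V, \<psi>).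
     holomorphic_map_on (\<phi> ` (U \<inter> V)) (\<psi> \<circ> inv_into U \<phi>) \<and>
     holomorphic_map_on (\<psi> ` (U \<inter> V)) (\<phi> \<circ> inv_into V \<psi>))"

definition complex_manifold :: "('p, complex^'n) charted_space \<Rightarrow> bool" where
  "complex_manifold M \<longleftrightarrow>
     Hausdorff_space (top_of M) \<and> second_countable (top_of M) \<and>
     (\<Union>(U, \<phi>)\<in>charts M. U) = topspace (top_of M) \<and>
     (\<forall>c\<in>charts M. is_chart (top_of M) c) \<and>
     (\<forall>c\<in>charts M. \<forall>d\<in>charts M. holomorphically_compatible c d)"

definition open_submanifold :: "('p, 'm) charted_space \<Rightarrow> 'p set \<Rightarrow> ('p, 'm) charted_space" where
  "open_submanifold M Z =
     \<lparr>top_of = subtopology (top_of M) Z, charts = (\<lambda>(U, \<phi>). (U \<inter> Z, \<phi>)) ` charts M\<rparr>"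

definition holomorphic_function :: "('p, complex^'n) charted_space \<Rightarrow> ('p \<Rightarrow> complex) \<Rightarrow> bool" where
  "holomorphic_function M f \<longleftrightarrow>
     (\<forall>(U, \<phi>)\<in>charts M. holomorphic_fun_on (\<phi> ` U) (f \<circ> inv_into U \<phi>))"

section \<open>Stein manifolds\<close>

definition paracompact_space :: "'p topology \<Rightarrow> bool" where
  "paracompact_space T \<longleftrightarrow>
     (\<forall>\<U>. (\<forall>U\<in>\<U>. openin T U) \<and> \<Union>\<U> = topspace T \<longrightarrow>
       (\<exists>\<V>. (\<forall>V\<in>\<V>. openin T V \<and> (\<exists>U\<in>\<U>. V \<subseteq> U)) \<and> \<Union>\<V> = topspace T \<and> locally_finite_in T \<V>))"

definition holomorphic_hull :: "('p, complex^'n) charted_space \<Rightarrow> 'p set \<Rightarrow> 'p set" where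
  "holomorphic_hull M K =
     {p \<in> topspace (top_of M). \<forall>f. holomorphic_function M f \<longrightarrow> cmod (f p) \<le> (SUP q\<in>K. cmod (f q))}"

text \<open>The nonemptiness condition avoids the unspecified supremum of the empty set of reals.\<close>

definition holomorphically_convex :: "('p, complex^'n) charted_space \<Rightarrow> bool" where
  "holomorphically_convex M \<longleftrightarrow>
     (\<forall>K. compactin (top_of M) K \<and> K \<noteq> {} \<longrightarrow> compactin (top_of M) (holomorphic_hull M K))"

definition holomorphically_separable :: "('p, complex^'n) charted_space \<Rightarrow> bool" where
  "holomorphically_separable M \<longleftrightarrow>
     (\<forall>p\<in>topspace (top_of M). \<forall>q\<in>topspace (top_of M). p \<noteq> q \<longrightarrow>
       (\<exists>f. holomorphic_function M f \<and> f p \<noteq> f q))"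

definition global_local_coordinates :: "('p, complex^'n) charted_space \<Rightarrow> bool" where
  "global_local_coordinates M \<longleftrightarrow>
     (\<forall>p\<in>topspace (top_of M). \<exists>F :: 'p \<Rightarrow> complex^'n.
       (\<forall>j. holomorphic_function M (\<lambda>q. F q $ j)) \<and>
       (\<exists>U. p \<in> U \<and> is_chart (top_of M) (U, F) \<and>
            (\<forall>c\<in>charts M. holomorphically_compatible (U, F) c)))"

definition Stein :: "('p, complex^'n) charted_space \<Rightarrow> bool" where
  "Stein M \<longleftrightarrow> complex_manifold M \<and> paracompact_space (top_of M) \<and>
     holomorphically_convex M \<and> holomorphically_separable M \<and> global_local_coordinates M"

section \<open>Diffeomorphisms with subsets of Euclidean spaces\<close>

text \<open>A complex manifold is regarded as a smooth manifold through its atlas. The target \<open>S\<close> is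
  an open subset or an embedded submanifold of a Euclidean space.\<close>

definition diffeomorphic_to ::
  "('p, complex^'n) charted_space \<Rightarrow> 'e::euclidean_space set \<Rightarrow> bool" where
  "diffeomorphic_to M S \<longleftrightarrow>
     (\<exists>f. homeomorphic_map (top_of M) (top_of_set S) f \<and>
       (\<forall>(U, \<phi>)\<in>charts M. smooth_on (\<phi> ` U) (f \<circ> inv_into U \<phi>) \<and>
          smooth_on (f ` U) (\<phi> \<circ> inv_into (topspace (top_of M)) f)))"

section \<open>Standard handlebodies and surfaces\<close>

text \<open>The set where \<open>planar_fun k\<close> is positive is the open disk of radius \<open>3k + 1\<close> about \<open>0\<close> with
  the \<open>k\<close> disjoint closed unit disks centred at \<open>0, 3, \<dots>, 3(k - 1)\<close> removed. Its boundary is the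
  zero set, consisting of \<open>k + 1\<close> disjoint circles, along which the gradient does not vanish.\<close>

definition planar_fun :: "nat \<Rightarrow> complex \<Rightarrow> real" where
  "planar_fun k p =
     ((3 * real k + 1)\<^sup>2 - (cmod p)\<^sup>2) * (\<Prod>i<k. (cmod (p - of_nat (3 * i)))\<^sup>2 - 1)"

text \<open>The boundary connected sum of \<open>k\<close> copies of \<open>S\<^sup>1 \<times> B\<^sup>3\<close> is the thickening by a disk
  of a disk with \<open>k\<close> holes. We realize its interior as an open set of \<open>\<complex> \<times> \<complex>\<close>, i.e. of
  four-dimensional real space.\<close>

definition handlebody :: "nat \<Rightarrow> (complex \<times> complex) set" where
  "handlebody k = {(p, w). (cmod w)\<^sup>2 < planar_fun k p}"

text \<open>The closed oriented surface of genus \<open>g\<close> is the double of a disk with \<open>g\<close> holes, i.e. the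
  boundary of the three-dimensional handlebody \<open>z\<^sup>2 < planar_fun g p\<close> in \<open>\<complex> \<times> \<real>\<close>.\<close>

definition genus_surface :: "nat \<Rightarrow> (complex \<times> real) set" where
  "genus_surface g = {(p, z). z\<^sup>2 = planar_fun g p}"

text \<open>For \<open>k = 0\<close> the handlebody is literally the open ball. For \<open>k = 1\<close>, smooth parametrizations
  by \<open>S\<^sup>1 \<times> B\<^sup>3\<close> and \<open>S\<^sup>1 \<times> S\<^sup>1\<close> (with smooth inverses) can be given explicitly.\<close>

lemma handlebody_0: "handlebody 0 = ball 0 1"
  by (auto simp: handlebody_def planar_fun_def dist_norm norm_Pair real_sqrt_lt_1_iff algebra_simps)

lemma planar_fun_1: "planar_fun 1 p = (15/2)\<^sup>2 - ((cmod p)\<^sup>2 - 17/2)\<^sup>2"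
  by (simp add: planar_fun_def power2_eq_square field_simps)

lemma bij_betw_rotation:
  fixes P :: "real \<Rightarrow> 'w::real_vector \<Rightarrow> bool"
  assumes P: "\<And>t w. P t w \<Longrightarrow> \<bar>t\<bar> \<le> 1"
  shows "bij_betw (\<lambda>(u, t, w). (sqrt (17/2 + 15/2 * t) *\<^sub>R u, (15/2) *\<^sub>R w))
     (sphere (0::complex) 1 \<times> {(t, w). P t w})
     {(p, w). P (((cmod p)\<^sup>2 - 17/2) / (15/2)) ((2/15) *\<^sub>R w)}"
    (is "bij_betw ?f ?A ?B")
proof (rule bij_betwI[where g = "\<lambda>(p, w). (sgn p, ((cmod p)\<^sup>2 - 17/2) / (15/2), (2/15) *\<^sub>R w)"])
  have pos: "17/2 + 15/2 * t > 0" if "P t w" for t w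
    using P[OF that] by (simp add: abs_le_iff)
  show "?f \<in> ?A \<rightarrow> ?B"
  proof clarsimp
    fix t w assume *: "P t w"
    have "(sqrt (17/2 + 15 * t / 2))\<^sup>2 = 17/2 + 15 * t / 2"
      using pos[OF *] by simp
    then show "P (((sqrt (17/2 + 15 * t / 2))\<^sup>2 * 2 - 17) / 15) w"
      using * by simp
  qed
  show "(\<lambda>(p, w). (sgn p, ((cmod p)\<^sup>2 - 17/2) / (15/2), (2/15) *\<^sub>R w)) \<in> ?B \<rightarrow> ?A"
  proof clarsimp
    fix p and w :: 'w assume *: "P (((cmod p)\<^sup>2 * 2 - 17) / 15) ((2/15) *\<^sub>R w)"
    have "p \<noteq> 0" using P[OF *] by auto
    then show "cmod (sgn p) = 1" by (simp add: norm_sgn)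
  qed
  show "(\<lambda>(p, w). (sgn p, ((cmod p)\<^sup>2 - 17/2) / (15/2), (2/15) *\<^sub>R w)) (?f x) = x" if A: "x \<in> ?A" for x
  proof -
    obtain u t w where x: "x = (u, t, w)" "cmod u = 1" "P t w"
      using A by (cases x) auto
    define r where "r = sqrt (17/2 + 15/2 * t)"
    have r: "r > 0" "r\<^sup>2 = 17/2 + 15/2 * t" using pos[OF x(3)] by (simp_all add: r_def)
    have "sgn (r *\<^sub>R u) = u" "(cmod (r *\<^sub>R u))\<^sup>2 = r\<^sup>2"
      using r(1) x(2) by (simp_all add: sgn_scaleR sgn_div_norm)
    then have "(sgn (r *\<^sub>R u), ((cmod (r *\<^sub>R u))\<^sup>2 - 17/2) / (15/2),
        (2/15) *\<^sub>R (15/2) *\<^sub>R w) = (u, t, w)"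
      using r(2) by (simp del: norm_scaleR)
    then show ?thesis by (simp only: x(1) r_def prod.case)
  qed
  show "?f ((\<lambda>(p, w). (sgn p, ((cmod p)\<^sup>2 - 17/2) / (15/2), (2/15) *\<^sub>R w)) y) = y" if "y \<in> ?B" for y
  proof -
    obtain p w where y: "y = (p, w)" by (cases y)
    have "sqrt (17/2 + 15/2 * (((cmod p)\<^sup>2 - 17/2) / (15/2))) = cmod p"
      by (simp add: field_simps)
    moreover have "cmod p *\<^sub>R sgn p = p"
      by (cases "p = 0") (simp_all add: sgn_div_norm)
    ultimately have "(sqrt (17/2 + 15/2 * (((cmod p)\<^sup>2 - 17/2) / (15/2))) *\<^sub>R sgn p,
        (15/2) *\<^sub>R (2/15) *\<^sub>R w) = (p, w)"
      by (simp only: scaleR_scaleR) simp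
    then show ?thesis by (simp only: y prod.case)
  qed
qed

lemma handlebody_1:
  "bij_betw (\<lambda>(u, t, w). (sqrt (17/2 + 15/2 * t) *\<^sub>R u, (15/2) *\<^sub>R w))
     (sphere (0::complex) 1 \<times> ball (0::real \<times> complex) 1) (handlebody 1)"
proof -
  have "{(t, w). t\<^sup>2 + (cmod w)\<^sup>2 < 1} = ball (0::real \<times> complex) 1"
    by (auto simp: dist_norm norm_Pair)
  moreover have "{(p, w). (((cmod p)\<^sup>2 - 17/2) / (15/2))\<^sup>2 + (cmod ((2/15) *\<^sub>R w))\<^sup>2 < 1} = handlebody 1"
    unfolding handlebody_def planar_fun_1 by (auto simp: power2_eq_square field_simps)
  moreover have "\<bar>t\<bar> \<le> 1" if "t\<^sup>2 + (cmod w)\<^sup>2 < 1" for t :: real and w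
  proof -
    have "t\<^sup>2 \<le> 1" using that zero_le_power2[of "cmod w"] by linarith
    then show ?thesis by (simp add: abs_square_le_1)
  qed
  ultimately show ?thesis
    using bij_betw_rotation[of "\<lambda>t w. t\<^sup>2 + (cmod w)\<^sup>2 < 1"] by auto
qed

lemma genus_surface_1:
  "bij_betw (\<lambda>(u, t, w). (sqrt (17/2 + 15/2 * t) *\<^sub>R u, (15/2) *\<^sub>R w))
     (sphere (0::complex) 1 \<times> sphere (0::real \<times> real) 1) (genus_surface 1)"
proof -
  have "{(t, w). t\<^sup>2 + w\<^sup>2 = 1} = sphere (0::real \<times> real) 1"
    by (auto simp: dist_norm norm_Pair)
  moreover have "{(p, w::real). (((cmod p)\<^sup>2 - 17/2) / (15/2))\<^sup>2 + ((2/15) *\<^sub>R w)\<^sup>2 = 1} = genus_surface 1"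
    unfolding genus_surface_def planar_fun_1 by (auto simp: power2_eq_square field_simps)
  moreover have "\<bar>t\<bar> \<le> 1" if "t\<^sup>2 + w\<^sup>2 = 1" for t w :: real
  proof -
    have "t\<^sup>2 \<le> 1" using that zero_le_power2[of w] by linarith
    then show ?thesis by (simp add: abs_square_le_1)
  qed
  ultimately show ?thesis
    using bij_betw_rotation[of "\<lambda>t (w::real). t\<^sup>2 + w\<^sup>2 = 1"] by auto
qed

section \<open>Stein trisections\<close>

text \<open>The index type \<open>3\<close> consists of the integers modulo 3, so \<open>i + 1\<close> is cyclic.\<close>

definition Stein_trisection ::
  "('p, complex^2) charted_space \<Rightarrow> nat \<Rightarrow> (3 \<Rightarrow> nat) \<Rightarrow> (3 \<Rightarrow> 'p set) \<Rightarrow> bool" where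
  "Stein_trisection X g k Z \<longleftrightarrow>
     complex_manifold X \<and>
     (\<forall>i. openin (top_of X) (Z i) \<and> Stein (open_submanifold X (Z i))) \<and>
     (\<Union>i. Z i) = topspace (top_of X) \<and>
     (\<forall>i. diffeomorphic_to (open_submanifold X (Z i)) (handlebody (k i))) \<and>
     (\<forall>i. diffeomorphic_to (open_submanifold X (Z i \<inter> Z (i + 1))) (handlebody g)) \<and>
     diffeomorphic_to (open_submanifold X (\<Inter>i. Z i)) (genus_surface g \<times> ball (0::complex) 1)"

definition admits_Stein_trisection :: "('p, complex^2) charted_space \<Rightarrow> nat \<Rightarrow> nat \<Rightarrow> bool" where
  "admits_Stein_trisection X g k \<longleftrightarrow> (\<exists>Z. Stein_trisection X g (\<lambda>_. k) Z)"

section \<open>The complex projective plane\<close>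

definition CP2_points :: "(complex^3) set set" where
  "CP2_points = {vec.span {v} |v. v \<noteq> 0}"

text \<open>The quotient topology from the nonzero vectors.\<close>

definition CP2_topology :: "(complex^3) set topology" where
  "CP2_topology = topology (\<lambda>\<U>. \<U> \<subseteq> CP2_points \<and> open {v. v \<noteq> 0 \<and> vec.span {v} \<in> \<U>})"

lemma openin_CP2_topology:
  "openin CP2_topology \<U> \<longleftrightarrow> \<U> \<subseteq> CP2_points \<and> open {v. v \<noteq> 0 \<and> vec.span {v} \<in> \<U>}"
proof -
  have "istopology (\<lambda>\<U>. \<U> \<subseteq> CP2_points \<and> open {v::complex^3. v \<noteq> 0 \<and> vec.span {v} \<in> \<U>})"
    unfolding istopology_def
  proof (intro conjI allI impI)
    fix S T :: "(complex^3) set set"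
    assume a: "S \<subseteq> CP2_points \<and> open {v. v \<noteq> 0 \<and> vec.span {v} \<in> S}"
      "T \<subseteq> CP2_points \<and> open {v. v \<noteq> 0 \<and> vec.span {v} \<in> T}"
    show "S \<inter> T \<subseteq> CP2_points" using a by blast
    have "{v. v \<noteq> 0 \<and> vec.span {v} \<in> S \<inter> T} =
        {v. v \<noteq> 0 \<and> vec.span {v} \<in> S} \<inter> {v. v \<noteq> 0 \<and> vec.span {v} \<in> T}" by blast
    then show "open {v. v \<noteq> 0 \<and> vec.span {v} \<in> S \<inter> T}" using a by (simp add: open_Int)
  next
    fix \<K> :: "(complex^3) set set set"
    assume a: "\<forall>K\<in>\<K>. K \<subseteq> CP2_points \<and> open {v. v \<noteq> 0 \<and> vec.span {v} \<in> K}"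
    show "\<Union>\<K> \<subseteq> CP2_points" using a by blast
    have "{v. v \<noteq> 0 \<and> vec.span {v} \<in> \<Union>\<K>} = (\<Union>K\<in>\<K>. {v. v \<noteq> 0 \<and> vec.span {v} \<in> K})" by blast
    then show "open {v. v \<noteq> 0 \<and> vec.span {v} \<in> \<Union>\<K>}" using a by (simp add: open_UN)
  qed
  then show ?thesis by (simp add: CP2_topology_def)
qed

text \<open>The affine charts \<open>[z\<^sub>1 : z\<^sub>2 : z\<^sub>3] \<mapsto> (z\<^sub>i\<^sub>+\<^sub>1 / z\<^sub>i, z\<^sub>i\<^sub>+\<^sub>2 / z\<^sub>i)\<close>, indices modulo 3: on the line
  they evaluate the coordinates of the unique vector \<open>v\<close> with \<open>v $ i = 1\<close>.\<close>

definition CP2_affine_domain :: "3 \<Rightarrow> (complex^3) set set" where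
  "CP2_affine_domain i = {L \<in> CP2_points. \<exists>v\<in>L. v $ i \<noteq> 0}"

definition CP2_affine_coords :: "3 \<Rightarrow> (complex^3) set \<Rightarrow> complex^2" where
  "CP2_affine_coords i L = (let v = (THE v. v \<in> L \<and> v $ i = 1) in vector [v $ (i + 1), v $ (i + 2)])"

definition CP2 :: "((complex^3) set, complex^2) charted_space" where
  "CP2 = \<lparr>top_of = CP2_topology,
          charts = range (\<lambda>i. (CP2_affine_domain i, CP2_affine_coords i))\<rparr>"

lemma topspace_CP2: "topspace (top_of CP2) = CP2_points"
proof -
  have "{v::complex^3. v \<noteq> 0 \<and> vec.span {v} \<in> CP2_points} = - {0}"
    by (auto simp: CP2_points_def)
  then have "openin CP2_topology CP2_points"
    by (simp add: openin_CP2_topology open_Compl)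
  moreover have "\<U> \<subseteq> CP2_points" if "openin CP2_topology \<U>" for \<U>
    using that by (simp add: openin_CP2_topology)
  ultimately show ?thesis
    by (auto simp: CP2_def topspace_def)
qed

lemma CP2_affine_coords_span:
  assumes "v $ i \<noteq> 0"
  shows "CP2_affine_coords i (vec.span {v}) = vector [v $ (i + 1) / v $ i, v $ (i + 2) / v $ i]"
proof -
  have "(THE w. w \<in> vec.span {v} \<and> w $ i = 1) = (1 / v $ i) *s v"
    using assms by (intro the_equality) (auto simp: vec.span_singleton nonzero_eq_divide_eq)
  then show ?thesis by (simp add: CP2_affine_coords_def)
qed

end

theory Submission
  imports Defs
begin

text \<open>Take \<open>Z\<^sub>i = {\<bar>z\<^sub>i\<^sub>+\<^sub>1\<bar>\<^sup>2 + \<bar>z\<^sub>i\<^sub>+\<^sub>2\<bar>\<^sup>2 < 5 \<bar>z\<^sub>i\<bar>\<^sup>2}\<close>. In the \<open>i\<close>-th affine chart this is a round ball,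
  hence Stein, and every point lies in the \<open>Z\<^sub>i\<close> of a coordinate of largest modulus. All regions are
  invariant under the torus action and are cut out by affine inequalities in the squared moduli
  \<open>X\<close>, \<open>Y\<close> of the affine coordinates: \<open>Z\<^sub>i \<inter> Z\<^sub>i\<^sub>+\<^sub>1\<close> lies over a triangle with one side on \<open>Y = 0\<close>,
  where one circle of the torus collapses, and so is a solid \<open>S\<^sup>1 \<times> B\<^sup>3\<close>, while
  \<open>Z\<^sub>1 \<inter> Z\<^sub>2 \<inter> Z\<^sub>3\<close> lies over an open triangle interior to the moment polytope and is a torus times
  a disk. Any radius squared greater than \<open>2\<close> would do; \<open>5\<close> keeps the constants simple.\<close>

section \<open>Smooth maps on open sets\<close>

text \<open>The models \<open>handlebody\<close> and \<open>genus_surface\<close> are fixed sets, so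
  each region needs an explicit map onto its model with an explicit inverse, both smooth. What
  constrains these maps is the collapsed circle in a pairwise intersection, where the second affine
  coordinate \<open>y\<close> vanishes and \<open>cmod y\<close> is not smooth. There the formulas
  may use \<open>y\<close> and its squared modulus only; hence \<open>y\<close> is scaled linearly
  and the whole fit is made by changing the modulus of the other coordinate. In the triple
  intersection neither coordinate vanishes, so moduli and arguments can be treated separately. The
  numbers 17/2 and 15/2 come from the model: for one hole \<open>planar_fun\<close> vanishes on the
  circles of radius 1 and 4, so the squared modulus of \<open>p\<close> runs over an interval with
  ends 1 and 16, centre 17/2 and half-length 15/2. The 4 in \<open>4 - Y\<close> is the height of
  the triangle of a pairwise intersection, whose apex is \<open>X = 1\<close>,
  \<open>Y = 4\<close>.\<close>

lemma C_k_on_cong: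
  assumes "open S" "\<And>x. x \<in> S \<Longrightarrow> f x = g x" "C_k_on k f S"
  shows "C_k_on k g S"
  using assms(2,3)
proof (induction k arbitrary: f g)
  case 0
  then show ?case by (simp cong: continuous_on_cong)
next
  case (Suc k)
  have der: "(g has_derivative frechet_derivative f (at x)) (at x)" if "x \<in> S" for x
  proof (rule has_derivative_transform_within_open[OF _ assms(1) that Suc.prems(1)])
    show "(f has_derivative frechet_derivative f (at x)) (at x)"
      using Suc.prems(2) that by (simp add: frechet_derivative_works[symmetric])
  qed
  then have "frechet_derivative g (at x) = frechet_derivative f (at x)" if "x \<in> S" for x
    using frechet_derivative_at[OF der[OF that]] by simp
  then have "C_k_on k (\<lambda>x. frechet_derivative g (at x) v) S" for v
    using Suc.prems(2) by (auto intro: Suc.IH[of "\<lambda>x. frechet_derivative f (at x) v"])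
  then show ?case
    using der by (auto simp: differentiable_def)
qed

text \<open>\<open>C_k_on\<close> is phrased with the operator \<open>frechet_derivative\<close>;
  uniqueness of derivatives allows any explicit formula \<open>D\<close> in its place. The closure
  rules below rest on this.\<close>

lemma C_k_on_SucI:
  assumes "open S" "\<And>x. x \<in> S \<Longrightarrow> (f has_derivative D x) (at x)"
    "\<And>v. C_k_on k (\<lambda>x. D x v) S"
  shows "C_k_on (Suc k) f S"
proof -
  have "frechet_derivative f (at x) = D x" if "x \<in> S" for x
    using frechet_derivative_at[OF assms(2)[OF that]] by simp
  then have "C_k_on k (\<lambda>x. frechet_derivative f (at x) v) S" for v
    using C_k_on_cong[OF assms(1) _ assms(3)[of v]] by simp
  then show ?thesis
    using assms(2) by (auto simp: differentiable_def)
qed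

text \<open>The recursion does not say directly that \<open>f\<close> has lower order, so this takes
  an induction, with continuity of differentiable maps as base case. Product and chain rules need it
  because their derivatives also contain undifferentiated functions.\<close>

lemma C_k_on_SucD:
  assumes "C_k_on (Suc k) f S"
  shows "C_k_on k f S"
  using assms
proof (induction k arbitrary: f)
  case 0
  then show ?case
    by (auto intro!: continuous_at_imp_continuous_on differentiable_imp_continuous_within)
next
  case (Suc k)
  from Suc.prems show ?case
    by (subst C_k_on.simps(2), subst (asm) C_k_on.simps(2)) (blast intro: Suc.IH)
qed

lemma C_k_on_subset:
  assumes "C_k_on k f S" "T \<subseteq> S"
  shows "C_k_on k f T"
  using assms(1)
proof (induction k arbitrary: f)
  case 0
  then show ?case using assms(2) continuous_on_subset by auto
next
  case (Suc k)
  then show ?case using assms(2) by auto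
qed

lemma C_k_on_const: "open S \<Longrightarrow> C_k_on k (\<lambda>x. c) S"
proof (induction k arbitrary: c)
  case (Suc k)
  then show ?case by (intro C_k_on_SucI[where D = "\<lambda>x v. 0"]) auto
qed simp

lemma C_k_on_linear:
  assumes "open S" "bounded_linear L"
  shows "C_k_on k L S"
proof (cases k)
  case 0
  then show ?thesis using assms by (simp add: linear_continuous_on)
next
  case (Suc j)
  show ?thesis unfolding Suc
    using assms by (intro C_k_on_SucI[where D = "\<lambda>x. L"] C_k_on_const)
      (auto intro: bounded_linear_imp_has_derivative)
qed

lemma C_k_on_add:
  assumes "open S" "C_k_on k f S" "C_k_on k g S"
  shows "C_k_on k (\<lambda>x. f x + g x) S"
  using assms(2,3)
proof (induction k arbitrary: f g)
  case 0
  then show ?case by (simp add: continuous_on_add)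
next
  case (Suc k)
  then show ?case
    by (intro C_k_on_SucI[OF assms(1), where
          D = "\<lambda>x v. frechet_derivative f (at x) v + frechet_derivative g (at x) v"])
      (auto intro!: has_derivative_add simp: frechet_derivative_works[symmetric])
qed

lemma C_k_on_sum:
  assumes "open S" "\<And>i. i \<in> I \<Longrightarrow> C_k_on k (f i) S"
  shows "C_k_on k (\<lambda>x. \<Sum>i\<in>I. f i x) S"
  using assms(2)
  by (induction I rule: infinite_finite_induct) (auto intro!: C_k_on_add C_k_on_const assms(1))

text \<open>The derivative is a sum of two values of the same \<open>B\<close>, each with one
  argument differentiated, so the induction stays within statements of this form.\<close>

lemma C_k_on_bilinear:
  assumes "open S" "bounded_bilinear B" "C_k_on k f S" "C_k_on k g S"
  shows "C_k_on k (\<lambda>x. B (f x) (g x)) S"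
  using assms(3,4)
proof (induction k arbitrary: f g)
  case 0
  then show ?case using bounded_bilinear.continuous_on[OF assms(2)] by auto
next
  case (Suc k)
  note fg = C_k_on_SucD[OF Suc.prems(1)] C_k_on_SucD[OF Suc.prems(2)]
  show ?case
    using Suc.prems fg
    by (intro C_k_on_SucI[OF assms(1), where D = "\<lambda>x v. B (f x) (frechet_derivative g (at x) v) +
          B (frechet_derivative f (at x) v) (g x)"] C_k_on_add[OF assms(1)] Suc.IH
          bounded_bilinear.FDERIV[OF assms(2)])
      (auto simp: frechet_derivative_works[symmetric])
qed

lemmas C_k_on_mult = C_k_on_bilinear[OF _ bounded_bilinear_mult]
lemmas C_k_on_scaleR = C_k_on_bilinear[OF _ bounded_bilinear_scaleR]

lemma C_k_on_linear_compose:
  assumes "open S" "bounded_linear L" "C_k_on k f S"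
  shows "C_k_on k (\<lambda>x. L (f x)) S"
  using assms(3)
proof (induction k arbitrary: f)
  case 0
  then show ?case using bounded_linear.continuous_on[OF assms(2)] by auto
next
  case (Suc k)
  then show ?case
    by (intro C_k_on_SucI[OF assms(1), where D = "\<lambda>x v. L (frechet_derivative f (at x) v)"]
          bounded_linear.has_derivative[OF assms(2)])
      (auto simp: frechet_derivative_works[symmetric])
qed

text \<open>The chain rule expresses the derivative of a composite in the direction \<open>v\<close> through the
  coordinates of \<open>D f v\<close>, which keeps the induction within functions of class \<open>C\<^sup>k\<close>.\<close>

lemma C_k_on_compose:
  fixes f :: "'a::euclidean_space \<Rightarrow> 'b::euclidean_space" and g :: "'b \<Rightarrow> 'c::real_normed_vector"
  assumes "open S" "C_k_on k f S" "C_k_on k g T" "f ` S \<subseteq> T"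
  shows "C_k_on k (\<lambda>x. g (f x)) S"
  using assms(2,3)
proof (induction k arbitrary: g)
  case 0
  then show ?case using assms(4) continuous_on_compose2[of T g S f] by simp
next
  case (Suc k)
  let ?f' = "\<lambda>x. frechet_derivative f (at x)" and ?g' = "\<lambda>x. frechet_derivative g (at x)"
  have f': "(f has_derivative ?f' x) (at x)" if "x \<in> S" for x
    using Suc.prems(1) that by (simp add: frechet_derivative_works[symmetric])
  have g': "(g has_derivative ?g' (f x)) (at (f x))" if "x \<in> S" for x
    using Suc.prems(2) that assms(4) by (auto simp: frechet_derivative_works[symmetric])
  have der: "((\<lambda>x. g (f x)) has_derivative
      (\<lambda>v. \<Sum>b\<in>Basis. (?f' x v \<bullet> b) *\<^sub>R ?g' (f x) b)) (at x)" if "x \<in> S" for x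
  proof -
    have "linear (?g' (f x))"
      using g'[OF that] has_derivative_linear by blast
    have "?g' (f x) w = (\<Sum>b\<in>Basis. (w \<bullet> b) *\<^sub>R ?g' (f x) b)" for w
    proof -
      have "?g' (f x) w = ?g' (f x) (\<Sum>b\<in>Basis. (w \<bullet> b) *\<^sub>R b)"
        by (simp add: euclidean_representation)
      also have "\<dots> = (\<Sum>b\<in>Basis. (w \<bullet> b) *\<^sub>R ?g' (f x) b)"
        using \<open>linear (?g' (f x))\<close> by (simp add: linear_sum linear_scale)
      finally show ?thesis .
    qed
    then have "(\<lambda>v. ?g' (f x) (?f' x v)) = (\<lambda>v. \<Sum>b\<in>Basis. (?f' x v \<bullet> b) *\<^sub>R ?g' (f x) b)"
      by (intro ext)
    then show ?thesis
      using has_derivative_compose[OF f'[OF that] g'[OF that]] by (simp only:)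
  qed
  show ?case
  proof (rule C_k_on_SucI[OF assms(1) der])
    show "C_k_on k (\<lambda>x. \<Sum>b\<in>Basis. (?f' x v \<bullet> b) *\<^sub>R ?g' (f x) b) S" for v
      using Suc.prems
      by (intro C_k_on_sum C_k_on_scaleR assms(1) Suc.IH[OF C_k_on_SucD]
          C_k_on_linear_compose[OF _ bounded_linear_inner_left]) auto
  qed
qed

text \<open>Openness is built in so that most closure rules need no separate openness
  condition.\<close>

definition Cinf_on :: "('a::euclidean_space \<Rightarrow> 'b::real_normed_vector) \<Rightarrow> 'a set \<Rightarrow> bool" where
  "Cinf_on f S \<longleftrightarrow> open S \<and> (\<forall>k. C_k_on k f S)"

lemma Cinf_on_open: "Cinf_on f S \<Longrightarrow> open S"
  by (simp add: Cinf_on_def)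

lemma Cinf_on_continuous: "Cinf_on f S \<Longrightarrow> continuous_on S f"
  unfolding Cinf_on_def by (metis C_k_on.simps(1))

lemma Cinf_on_subset: "Cinf_on f S \<Longrightarrow> open T \<Longrightarrow> T \<subseteq> S \<Longrightarrow> Cinf_on f T"
  unfolding Cinf_on_def using C_k_on_subset by blast

lemma Cinf_on_const: "open S \<Longrightarrow> Cinf_on (\<lambda>x. c) S"
  by (simp add: Cinf_on_def C_k_on_const)

lemma Cinf_on_linear: "open S \<Longrightarrow> bounded_linear L \<Longrightarrow> Cinf_on L S"
  by (simp add: Cinf_on_def C_k_on_linear)

lemma Cinf_on_linear_compose: "bounded_linear L \<Longrightarrow> Cinf_on f S \<Longrightarrow> Cinf_on (\<lambda>x. L (f x)) S"
  by (simp add: Cinf_on_def C_k_on_linear_compose)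

lemma Cinf_on_add: "Cinf_on f S \<Longrightarrow> Cinf_on g S \<Longrightarrow> Cinf_on (\<lambda>x. f x + g x) S"
  by (simp add: Cinf_on_def C_k_on_add)

lemma Cinf_on_minus: "Cinf_on f S \<Longrightarrow> Cinf_on (\<lambda>x. - f x) S"
  by (rule Cinf_on_linear_compose[OF bounded_linear_minus[OF bounded_linear_ident]])

lemma Cinf_on_diff: "Cinf_on f S \<Longrightarrow> Cinf_on g S \<Longrightarrow> Cinf_on (\<lambda>x. f x - g x) S"
  using Cinf_on_add[OF _ Cinf_on_minus] by fastforce

lemma Cinf_on_sum:
  assumes "open S" "\<And>i. i \<in> I \<Longrightarrow> Cinf_on (f i) S"
  shows "Cinf_on (\<lambda>x. \<Sum>i\<in>I. f i x) S"
  using assms by (simp add: Cinf_on_def C_k_on_sum)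

lemma Cinf_on_bilinear:
  "bounded_bilinear B \<Longrightarrow> Cinf_on f S \<Longrightarrow> Cinf_on g S \<Longrightarrow> Cinf_on (\<lambda>x. B (f x) (g x)) S"
  by (simp add: Cinf_on_def C_k_on_bilinear)

lemmas Cinf_on_mult = Cinf_on_bilinear[OF bounded_bilinear_mult]
lemmas Cinf_on_scaleR = Cinf_on_bilinear[OF bounded_bilinear_scaleR]

lemma Cinf_on_compose:
  fixes f :: "'a::euclidean_space \<Rightarrow> 'b::euclidean_space" and g :: "'b \<Rightarrow> 'c::real_normed_vector"
  shows "Cinf_on g T \<Longrightarrow> Cinf_on f S \<Longrightarrow> f ` S \<subseteq> T \<Longrightarrow> Cinf_on (\<lambda>x. g (f x)) S"
  by (auto simp: Cinf_on_def intro: C_k_on_compose)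

lemma Cinf_on_cong: "Cinf_on f S \<Longrightarrow> (\<And>x. x \<in> S \<Longrightarrow> f x = g x) \<Longrightarrow> Cinf_on g S"
  unfolding Cinf_on_def using C_k_on_cong by blast

lemma Cinf_on_power: "Cinf_on f S \<Longrightarrow> Cinf_on (\<lambda>x. f x ^ n :: 'b::real_normed_algebra_1) S"
  by (induction n) (auto intro!: Cinf_on_mult Cinf_on_const dest: Cinf_on_open)

section \<open>Maps into products and vector spaces\<close>

lemma Cinf_on_Pair:
  assumes "Cinf_on f S" "Cinf_on g S"
  shows "Cinf_on (\<lambda>x. (f x, g x)) S"
proof -
  have "bounded_linear (\<lambda>x. (x, 0))" "bounded_linear (\<lambda>x. (0, x))"
    by (auto intro!: bounded_linear_Pair bounded_linear_ident bounded_linear_zero)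
  then have "Cinf_on (\<lambda>x. (f x, 0) + (0, g x)) S"
    using assms by (intro Cinf_on_add Cinf_on_linear_compose[of "\<lambda>x. (x, 0)" f S] Cinf_on_linear_compose[of "Pair 0" g S])
  then show ?thesis by simp
qed

lemma bounded_linear_axis: "bounded_linear (axis i :: 'a::real_normed_vector \<Rightarrow> 'a ^ 'n)"
  by (rule bounded_linear_intro[where K = 1])
    (auto simp: axis_def vec_eq_iff norm_vec_def L2_set_def if_distrib[of norm] if_distrib[of "\<lambda>x. x\<^sup>2"] sum.delta
        cong: if_cong)

lemma vec_eq_sum_axis: "(x :: 'a::comm_monoid_add ^ 'n) = (\<Sum>j\<in>UNIV. axis j (x $ j))"
  by (simp add: vec_eq_iff axis_def sum.delta)

lemma Cinf_on_vecI:
  fixes F :: "'a::euclidean_space \<Rightarrow> 'b::real_normed_vector ^ 'n"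
  assumes "open S" "\<And>j. Cinf_on (\<lambda>x. F x $ j) S"
  shows "Cinf_on F S"
proof -
  have "Cinf_on (\<lambda>x. \<Sum>j\<in>UNIV. axis j (F x $ j)) S"
    by (intro Cinf_on_sum assms Cinf_on_linear_compose[OF bounded_linear_axis])
  then show ?thesis by (simp flip: vec_eq_sum_axis)
qed

lemma Cinf_on_vector_2:
  fixes f g :: "'a::euclidean_space \<Rightarrow> 'b::real_normed_vector"
  assumes "Cinf_on f S" "Cinf_on g S"
  shows "Cinf_on (\<lambda>x. vector [f x, g x] :: 'b ^ 2) S"
proof (rule Cinf_on_vecI)
  show "Cinf_on (\<lambda>x. (vector [f x, g x] :: 'b ^ 2) $ j) S" for j
    using exhaust_2[of j] assms by auto
qed (use assms Cinf_on_open in auto)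

section \<open>Elementary real functions\<close>

lemma C_k_on_Suc_real:
  fixes g :: "real \<Rightarrow> real"
  assumes "open S" "\<And>x. x \<in> S \<Longrightarrow> (g has_real_derivative g' x) (at x)" "C_k_on k g' S"
  shows "C_k_on (Suc k) g S"
proof (rule C_k_on_SucI[OF assms(1), where D = "\<lambda>x v. g' x * v"])
  show "(g has_derivative (\<lambda>v. g' x * v)) (at x)" if "x \<in> S" for x
    using assms(2)[OF that] by (simp add: has_field_derivative_def)
  show "C_k_on k (\<lambda>x. g' x * v) S" for v
    by (intro C_k_on_mult C_k_on_const assms)
qed

text \<open>The derivative is minus the square of the function itself, so each order follows from
  the previous one by the product rule.\<close>

lemma Cinf_on_inverse_real: "Cinf_on (inverse :: real \<Rightarrow> real) (- {0})"
proof -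
  have "C_k_on k (inverse :: real \<Rightarrow> real) (- {0})" for k
  proof (induction k)
    case (Suc k)
    show ?case
      by (intro C_k_on_Suc_real[where g' = "\<lambda>x. - 1 * (inverse x * inverse x)"]
            C_k_on_mult C_k_on_const Suc)
        (auto intro!: derivative_eq_intros)
  qed (auto intro: continuous_intros)
  then show ?thesis by (simp add: Cinf_on_def open_Compl)
qed

lemma Cinf_on_inverse:
  "Cinf_on f S \<Longrightarrow> (\<And>x. x \<in> S \<Longrightarrow> f x \<noteq> 0) \<Longrightarrow> Cinf_on (\<lambda>x. inverse (f x :: real)) S"
  by (rule Cinf_on_compose[OF Cinf_on_inverse_real]) auto

lemma Cinf_on_divide:
  "Cinf_on f S \<Longrightarrow> Cinf_on g S \<Longrightarrow> (\<And>x. x \<in> S \<Longrightarrow> g x \<noteq> 0) \<Longrightarrow> Cinf_on (\<lambda>x. f x / g x :: real) S"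
  unfolding divide_inverse by (intro Cinf_on_mult Cinf_on_inverse)

lemma Cinf_on_sqrt:
  assumes "Cinf_on f S" "\<And>x. x \<in> S \<Longrightarrow> f x > 0"
  shows "Cinf_on (\<lambda>x. sqrt (f x)) S"
proof -
  have "C_k_on k sqrt {0<..}" for k
  proof (induction k)
    case (Suc k)
    \<comment> \<open>This derivative is \<open>inverse\<close> after \<open>sqrt\<close>, so order
      \<open>k\<close> of \<open>sqrt\<close>, the induction hypothesis, passes to it by the chain
      rule.\<close>
    have "C_k_on k (\<lambda>x. inverse (sqrt x) / 2) {0<..}"
      unfolding divide_inverse
      using Cinf_on_inverse_real
      by (intro C_k_on_mult C_k_on_const C_k_on_compose[OF _ Suc, of inverse "- {0}"])
        (auto simp: Cinf_on_def)
    then show ?case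
      by (intro C_k_on_Suc_real[where g' = "\<lambda>x. inverse (sqrt x) / 2"])
        (auto intro!: derivative_eq_intros)
  qed (auto intro: continuous_intros)
  then have "Cinf_on sqrt {0<..}" by (simp add: Cinf_on_def)
  then show ?thesis using assms by (auto intro: Cinf_on_compose[OF _ assms(1)])
qed

lemma Cinf_on_ln:
  assumes "Cinf_on f S" "\<And>x. x \<in> S \<Longrightarrow> f x > 0"
  shows "Cinf_on (\<lambda>x. ln (f x :: real)) S"
proof -
  have "C_k_on k (ln :: real \<Rightarrow> real) {0<..}" for k
  proof (cases k)
    case 0
    then show ?thesis by (auto intro!: continuous_intros)
  next
    case (Suc j)
    \<comment> \<open>A case split suffices instead of an induction: the derivative of
      \<open>ln\<close> is already known to be smooth.\<close>
    have "C_k_on j (inverse :: real \<Rightarrow> real) {0<..}"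
      using Cinf_on_inverse_real by (auto simp: Cinf_on_def intro: C_k_on_subset)
    then show ?thesis unfolding Suc
      by (intro C_k_on_Suc_real[where g' = inverse])
        (auto intro!: derivative_eq_intros simp: field_simps)
  qed
  then have "Cinf_on (ln :: real \<Rightarrow> real) {0<..}" by (simp add: Cinf_on_def)
  then show ?thesis using assms by (auto intro: Cinf_on_compose[OF _ assms(1)])
qed

lemma Cinf_on_exp:
  assumes "Cinf_on f S"
  shows "Cinf_on (\<lambda>x. exp (f x :: real)) S"
proof -
  have "C_k_on k (exp :: real \<Rightarrow> real) UNIV" for k
  proof (induction k)
    case (Suc k)
    then show ?case by (intro C_k_on_Suc_real[where g' = exp]) auto
  qed (auto intro: continuous_intros)
  then have "Cinf_on (exp :: real \<Rightarrow> real) UNIV" by (simp add: Cinf_on_def)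
  then show ?thesis using assms by (auto intro: Cinf_on_compose[OF _ assms(1)])
qed

section \<open>Smooth functions with complex values\<close>

lemma Cinf_on_Re: "Cinf_on f S \<Longrightarrow> Cinf_on (\<lambda>x. Re (f x)) S"
  and Cinf_on_Im: "Cinf_on f S \<Longrightarrow> Cinf_on (\<lambda>x. Im (f x)) S"
  and Cinf_on_cnj: "Cinf_on f S \<Longrightarrow> Cinf_on (\<lambda>x. cnj (f x)) S"
  by (auto intro: Cinf_on_linear_compose bounded_linear_Re bounded_linear_Im bounded_linear_cnj)

lemma Cinf_on_complex_of_real: "Cinf_on f S \<Longrightarrow> Cinf_on (\<lambda>x. complex_of_real (f x)) S"
  by (rule Cinf_on_linear_compose[OF bounded_linear_of_real])

lemma Cinf_on_Complex:
  "Cinf_on f S \<Longrightarrow> Cinf_on g S \<Longrightarrow> Cinf_on (\<lambda>x. Complex (f x) (g x)) S"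
  unfolding Complex_eq
  by (intro Cinf_on_add Cinf_on_mult Cinf_on_complex_of_real Cinf_on_const)
    (auto dest: Cinf_on_open)

lemma Cinf_on_cmod_power2: "Cinf_on f S \<Longrightarrow> Cinf_on (\<lambda>x. (cmod (f x))\<^sup>2) S"
  unfolding cmod_power2 by (intro Cinf_on_add Cinf_on_power Cinf_on_Re Cinf_on_Im)

lemma Cinf_on_cmod:
  assumes "Cinf_on f S" "\<And>x. x \<in> S \<Longrightarrow> f x \<noteq> 0"
  shows "Cinf_on (\<lambda>x. cmod (f x)) S"
proof -
  have "Cinf_on (\<lambda>x. sqrt ((cmod (f x))\<^sup>2)) S"
    using assms by (intro Cinf_on_sqrt Cinf_on_cmod_power2) auto
  then show ?thesis by simp
qed

text \<open>The conjugate reduces complex division to the reciprocal of a positive real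
  function.\<close>

lemma Cinf_on_divide_complex:
  assumes "Cinf_on f S" "Cinf_on g S" "\<And>x. x \<in> S \<Longrightarrow> g x \<noteq> 0"
  shows "Cinf_on (\<lambda>x. f x / g x :: complex) S"
proof -
  have "Cinf_on (\<lambda>x. f x * (cnj (g x) * of_real (inverse ((cmod (g x))\<^sup>2)))) S"
    using assms
    by (intro Cinf_on_mult Cinf_on_cnj Cinf_on_complex_of_real Cinf_on_inverse
        Cinf_on_cmod_power2) auto
  moreover have "f x * (cnj (g x) * of_real (inverse ((cmod (g x))\<^sup>2))) = f x / g x" for x
    by (cases "g x = 0") (simp_all add: field_simps flip: complex_norm_square)
  ultimately show ?thesis by simp
qed

lemma Cinf_on_vec_nth: "open S \<Longrightarrow> Cinf_on (\<lambda>x. x $ i) S"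
  by (intro Cinf_on_linear bounded_linear_vec_nth)

lemma Cinf_on_ident: "open S \<Longrightarrow> Cinf_on (\<lambda>x. x) S"
  by (intro Cinf_on_linear bounded_linear_ident)

lemma Cinf_on_fst: "Cinf_on f S \<Longrightarrow> Cinf_on (\<lambda>x. fst (f x)) S"
  and Cinf_on_snd: "Cinf_on f S \<Longrightarrow> Cinf_on (\<lambda>x. snd (f x)) S"
  by (auto intro: Cinf_on_linear_compose bounded_linear_fst bounded_linear_snd)

lemmas Cinf_on_intros = Cinf_on_const Cinf_on_ident Cinf_on_vec_nth Cinf_on_fst Cinf_on_snd
  Cinf_on_Re Cinf_on_Im Cinf_on_complex_of_real Cinf_on_Complex Cinf_on_add Cinf_on_diff
  Cinf_on_minus Cinf_on_mult Cinf_on_scaleR Cinf_on_power Cinf_on_divide Cinf_on_divide_complex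
  Cinf_on_sqrt Cinf_on_ln Cinf_on_exp Cinf_on_cmod_power2 Cinf_on_cmod Cinf_on_Pair
  Cinf_on_vector_2

text \<open>\<open>smooth_on\<close> allows a different extension near each point; here a single one
  serves them all.\<close>

lemma Cinf_on_imp_smooth_on:
  assumes "Cinf_on g W" "S \<subseteq> W" "\<And>x. x \<in> S \<Longrightarrow> g x = f x"
  shows "smooth_on S f"
  unfolding smooth_on_def
proof
  fix x assume "x \<in> S"
  then show "\<exists>W g. open W \<and> x \<in> W \<and> (\<forall>k. C_k_on k g W) \<and> (\<forall>y\<in>W \<inter> S. g y = f y)"
    using assms by (intro exI[of _ W] exI[of _ g]) (auto simp: Cinf_on_def)
qed

section \<open>Holomorphic maps in several variables\<close>

lemma holomorphic_fun_on_const: "holomorphic_fun_on S (\<lambda>x. c)"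
  unfolding holomorphic_fun_on_def by (auto intro!: exI[of _ "\<lambda>v. 0"])

lemma holomorphic_fun_on_vec_nth: "holomorphic_fun_on S (\<lambda>x. x $ i)"
  unfolding holomorphic_fun_on_def
  by (auto intro!: exI[of _ "\<lambda>v. v $ i"] bounded_linear_imp_has_derivative bounded_linear_vec_nth)

lemma holomorphic_fun_on_subset: "holomorphic_fun_on S f \<Longrightarrow> T \<subseteq> S \<Longrightarrow> holomorphic_fun_on T f"
  unfolding holomorphic_fun_on_def by blast

lemma holomorphic_map_on_subset: "holomorphic_map_on S f \<Longrightarrow> T \<subseteq> S \<Longrightarrow> holomorphic_map_on T f"
  unfolding holomorphic_map_on_def using holomorphic_fun_on_subset by blast

lemma holomorphic_fun_on_continuous: "holomorphic_fun_on S f \<Longrightarrow> continuous_on S f"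
  unfolding holomorphic_fun_on_def
  by (meson continuous_at_imp_continuous_on has_derivative_continuous)

lemma holomorphic_fun_on_cong:
  assumes "open S" "holomorphic_fun_on S f" "\<And>x. x \<in> S \<Longrightarrow> f x = g x"
  shows "holomorphic_fun_on S g"
  unfolding holomorphic_fun_on_def
proof
  fix x assume x: "x \<in> S"
  with assms(2) obtain D where D: "(f has_derivative D) (at x)" "\<forall>c v. D (c *s v) = c * D v"
    unfolding holomorphic_fun_on_def by blast
  show "\<exists>D. (g has_derivative D) (at x) \<and> (\<forall>c v. D (c *s v) = c * D v)"
    using has_derivative_transform_within_open[OF D(1) assms(1) x assms(3)] D(2) by blast
qed

lemma holomorphic_map_on_cong:
  assumes "open S" "holomorphic_map_on S f" "\<And>x. x \<in> S \<Longrightarrow> f x = g x"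
  shows "holomorphic_map_on S g"
  using assms(2,3) unfolding holomorphic_map_on_def
  by (auto intro: holomorphic_fun_on_cong[OF assms(1)])

lemma holomorphic_fun_on_add:
  assumes "holomorphic_fun_on S f" "holomorphic_fun_on S g"
  shows "holomorphic_fun_on S (\<lambda>x. f x + g x)"
  unfolding holomorphic_fun_on_def
proof
  fix x assume x: "x \<in> S"
  with assms obtain D E where
    "(f has_derivative D) (at x)" "\<forall>c v. D (c *s v) = c * D v"
    "(g has_derivative E) (at x)" "\<forall>c v. E (c *s v) = c * E v"
    unfolding holomorphic_fun_on_def by meson
  then show "\<exists>D. ((\<lambda>x. f x + g x) has_derivative D) (at x) \<and> (\<forall>c v. D (c *s v) = c * D v)"
    by (intro exI[of _ "\<lambda>v. D v + E v"]) (auto intro: has_derivative_add simp: algebra_simps)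
qed

lemma holomorphic_fun_on_mult:
  assumes "holomorphic_fun_on S f" "holomorphic_fun_on S g"
  shows "holomorphic_fun_on S (\<lambda>x. f x * g x)"
  unfolding holomorphic_fun_on_def
proof
  fix x assume x: "x \<in> S"
  with assms obtain D E where
    "(f has_derivative D) (at x)" "\<forall>c v. D (c *s v) = c * D v"
    "(g has_derivative E) (at x)" "\<forall>c v. E (c *s v) = c * E v"
    unfolding holomorphic_fun_on_def by meson
  then show "\<exists>D. ((\<lambda>x. f x * g x) has_derivative D) (at x) \<and> (\<forall>c v. D (c *s v) = c * D v)"
    by (intro exI[of _ "\<lambda>v. f x * E v + D v * g x"])
      (auto dest: has_derivative_mult simp: algebra_simps)
qed

lemma holomorphic_fun_on_divide:
  assumes "holomorphic_fun_on S f" "holomorphic_fun_on S g" "\<And>x. x \<in> S \<Longrightarrow> g x \<noteq> 0"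
  shows "holomorphic_fun_on S (\<lambda>x. f x / g x)"
  unfolding holomorphic_fun_on_def
proof
  fix x assume x: "x \<in> S"
  with assms(1,2) obtain D E where
    "(f has_derivative D) (at x)" "\<forall>c v. D (c *s v) = c * D v"
    "(g has_derivative E) (at x)" "\<forall>c v. E (c *s v) = c * E v"
    unfolding holomorphic_fun_on_def by meson
  then show "\<exists>D. ((\<lambda>x. f x / g x) has_derivative D) (at x) \<and> (\<forall>c v. D (c *s v) = c * D v)"
    using assms(3)[OF x]
    by (intro exI[of _ "\<lambda>v. (D v * g x - f x * E v) / (g x * g x)"])
      (auto dest: has_derivative_divide' simp: algebra_simps)
qed

lemma holomorphic_fun_on_sum:
  assumes "\<And>i. i \<in> I \<Longrightarrow> holomorphic_fun_on S (f i)"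
  shows "holomorphic_fun_on S (\<lambda>x. \<Sum>i\<in>I. f i x)"
  using assms
  by (induction I rule: infinite_finite_induct)
    (auto intro: holomorphic_fun_on_const holomorphic_fun_on_add)

text \<open>The components of \<open>F\<close> assemble to its real derivative, complex linear in
  each coordinate; composing with the derivative of \<open>f\<close> preserves complex
  linearity.\<close>

lemma holomorphic_fun_on_compose:
  fixes F :: "complex^'n \<Rightarrow> complex^'m"
  assumes "holomorphic_map_on S F" "holomorphic_fun_on T f" "F ` S \<subseteq> T"
  shows "holomorphic_fun_on S (\<lambda>x. f (F x))"
  unfolding holomorphic_fun_on_def
proof
  fix x assume x: "x \<in> S"
  with assms(1) have "\<forall>j. \<exists>D. ((\<lambda>x. F x $ j) has_derivative D) (at x) \<and> (\<forall>c v. D (c *s v) = c * D v)"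
    unfolding holomorphic_map_on_def holomorphic_fun_on_def by blast
  then obtain D where D: "\<And>j. ((\<lambda>x. F x $ j) has_derivative D j) (at x)"
      "\<And>j c v. D j (c *s v) = c * D j v"
    by metis
  have "((\<lambda>x. \<Sum>j\<in>UNIV. axis j (F x $ j)) has_derivative (\<lambda>v. \<Sum>j\<in>UNIV. axis j (D j v))) (at x)"
    by (intro has_derivative_sum bounded_linear.has_derivative[OF bounded_linear_axis] D(1))
  moreover have "(\<Sum>j\<in>UNIV. axis j (D j v)) = (\<chi> j. D j v)" for v
    using vec_eq_sum_axis[of "\<chi> j. D j v"] by simp
  ultimately have F': "(F has_derivative (\<lambda>v. \<chi> j. D j v)) (at x)"
    by (simp flip: vec_eq_sum_axis)
  from x assms(2,3) obtain E where E: "(f has_derivative E) (at (F x))"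
      "\<forall>c v. E (c *s v) = c * E v"
    unfolding holomorphic_fun_on_def by blast
  have "(\<chi> j. D j (c *s v)) = c *s (\<chi> j. D j v)" for c v
    by (simp add: vec_eq_iff D(2))
  then show "\<exists>D. ((\<lambda>x. f (F x)) has_derivative D) (at x) \<and> (\<forall>c v. D (c *s v) = c * D v)"
    using has_derivative_compose[OF F' E(1)] E(2)
    by (intro exI[of _ "\<lambda>v. E (\<chi> j. D j v)"]) simp
qed

section \<open>Charts and open submanifolds\<close>

lemma is_chartD:
  assumes "is_chart T (U, \<phi>)"
  shows "openin T U" "open (\<phi> ` U)"
    "homeomorphic_map (subtopology T U) (top_of_set (\<phi> ` U)) \<phi>" "inj_on \<phi> U"
proof -
  show a: "openin T U" "open (\<phi> ` U)"
    "homeomorphic_map (subtopology T U) (top_of_set (\<phi> ` U)) \<phi>"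
    using assms by (auto simp: is_chart_def)
  have "topspace (subtopology T U) = U"
    using openin_subset[OF a(1)] by auto
  then show "inj_on \<phi> U"
    using homeomorphic_imp_injective_map[OF a(3)] by simp
qed

lemma is_chart_open_image:
  assumes "is_chart T (U, \<phi>)" "openin T V" "V \<subseteq> U"
  shows "open (\<phi> ` V)"
proof -
  have "openin (subtopology T U) V"
    using assms(2,3) by (metis inf.absorb_iff1 openin_subtopology)
  then have "openin (top_of_set (\<phi> ` U)) (\<phi> ` V)"
    using homeomorphic_map_openness_eq[OF is_chartD(3)[OF assms(1)]] by blast
  then show ?thesis
    using is_chartD(2)[OF assms(1)] openin_open_eq by blast
qed

lemma is_chart_restrict:
  assumes "is_chart T (U, \<phi>)" "openin T Z"
  shows "is_chart (subtopology T Z) (U \<inter> Z, \<phi>)"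
proof -
  note c = is_chartD[OF assms(1)]
  have top: "topspace (subtopology T U) = U"
    using openin_subset[OF c(1)] by auto
  have "homeomorphic_map (subtopology (subtopology T U) Z)
      (subtopology (top_of_set (\<phi> ` U)) (\<phi> ` (U \<inter> Z))) \<phi>"
    using c(4) by (intro homeomorphic_map_subtopologies[OF c(3)]) (auto simp: top simp del: topspace_subtopology dest: inj_onD)
  moreover have "subtopology (subtopology T U) Z = subtopology (subtopology T Z) (U \<inter> Z)"
    by (simp add: subtopology_subtopology Int_ac)
  moreover have "subtopology (top_of_set (\<phi> ` U)) (\<phi> ` (U \<inter> Z)) = top_of_set (\<phi> ` (U \<inter> Z))"
    by (simp add: subtopology_subtopology) (metis Int_absorb1 image_mono inf_le1)
  ultimately have "homeomorphic_map (subtopology (subtopology T Z) (U \<inter> Z))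
      (top_of_set (\<phi> ` (U \<inter> Z))) \<phi>" by simp
  moreover have "open (\<phi> ` (U \<inter> Z))"
    using is_chart_open_image[OF assms(1)] c(1) assms(2) by (simp add: openin_Int)
  moreover have "openin (subtopology T Z) (U \<inter> Z)"
    using c(1) openin_subtopology by blast
  ultimately show ?thesis by (simp add: is_chart_def)
qed

text \<open>Shrinking a chart domain changes the term \<open>inv_into\<close>, which depends on its
  set; injectivity makes the values agree.\<close>

lemma inv_into_restrict:
  assumes "inj_on \<phi> U" "V \<subseteq> U" "y \<in> \<phi> ` V"
  shows "inv_into V \<phi> y = inv_into U \<phi> y"
  using assms by (metis f_inv_into_f inj_on_subset inv_into_f_f inv_into_into subset_iff)

lemma holomorphically_compatible_restrict:
  assumes "is_chart T (U, \<phi>)" "is_chart T (V, \<psi>)" "openin T Z"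
    "holomorphically_compatible (U, \<phi>) (V, \<psi>)"
  shows "holomorphically_compatible (U \<inter> Z, \<phi>) (V \<inter> Z, \<psi>)"
proof -
  have half: "holomorphic_map_on (\<phi> ` (U \<inter> Z \<inter> (V \<inter> Z))) (\<psi> \<circ> inv_into (U \<inter> Z) \<phi>)"
    if U: "is_chart T (U, \<phi>)" and V: "is_chart T (V, \<psi>)"
      and h: "holomorphic_map_on (\<phi> ` (U \<inter> V)) (\<psi> \<circ> inv_into U \<phi>)" for U V \<phi> and \<psi> :: "'a \<Rightarrow> complex^'b"
  proof (rule holomorphic_map_on_cong)
    show "open (\<phi> ` (U \<inter> Z \<inter> (V \<inter> Z)))"
      using is_chartD(1)[OF U] is_chartD(1)[OF V] assms(3)
      by (intro is_chart_open_image[OF U] openin_Int) auto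
    show "holomorphic_map_on (\<phi> ` (U \<inter> Z \<inter> (V \<inter> Z))) (\<psi> \<circ> inv_into U \<phi>)"
      by (rule holomorphic_map_on_subset[OF h]) blast
    fix y assume "y \<in> \<phi> ` (U \<inter> Z \<inter> (V \<inter> Z))"
    then have "y \<in> \<phi> ` (U \<inter> Z)" by blast
    then show "(\<psi> \<circ> inv_into U \<phi>) y = (\<psi> \<circ> inv_into (U \<inter> Z) \<phi>) y"
      using inv_into_restrict[OF is_chartD(4)[OF U], of "U \<inter> Z" y] by simp
  qed
  show ?thesis
    using half[OF assms(1,2)] half[OF assms(2,1)] assms(4)
    by (simp add: holomorphically_compatible_def Int_ac)
qed

lemma complex_manifold_open_submanifold:
  assumes M: "complex_manifold M" and Z: "openin (top_of M) Z"
  shows "complex_manifold (open_submanifold M Z)"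
  unfolding complex_manifold_def
proof (intro conjI ballI)
  show "Hausdorff_space (top_of (open_submanifold M Z))"
    "second_countable (top_of (open_submanifold M Z))"
    using M by (auto simp: complex_manifold_def open_submanifold_def
        Hausdorff_space_subtopology second_countable_subtopology)
  have "(\<Union>(U, \<phi>)\<in>charts M. U) = topspace (top_of M)"
    using M by (simp add: complex_manifold_def)
  then show "(\<Union>(U, \<phi>)\<in>charts (open_submanifold M Z). U) = topspace (top_of (open_submanifold M Z))"
    by (auto simp: open_submanifold_def)
next
  fix c assume "c \<in> charts (open_submanifold M Z)"
  then show "is_chart (top_of (open_submanifold M Z)) c"
    using M Z by (auto simp: complex_manifold_def open_submanifold_def intro!: is_chart_restrict)
next
  fix c d assume "c \<in> charts (open_submanifold M Z)" "d \<in> charts (open_submanifold M Z)"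
  then obtain U \<phi> V \<psi> where "(U, \<phi>) \<in> charts M" "(V, \<psi>) \<in> charts M"
      and cd: "c = (U \<inter> Z, \<phi>)" "d = (V \<inter> Z, \<psi>)"
    by (auto simp: open_submanifold_def)
  then show "holomorphically_compatible c d"
    unfolding cd using M Z
    by (intro holomorphically_compatible_restrict[where T = "top_of M"])
      (auto simp: complex_manifold_def)
qed

section \<open>Manifolds with a global chart\<close>

text \<open>Paracompactness of metric spaces, transported: push the cover forward, refine it, pull
  the refinement back. As \<open>S\<close> is open, relatively open images are open in the ambient
  space, where the metric result applies.\<close>

lemma paracompact_space_homeomorphic:
  fixes S :: "'a::{metric_space, second_countable_topology} set"
  assumes hom: "homeomorphic_map T (top_of_set S) \<phi>" and "open S"
  shows "paracompact_space T"
  unfolding paracompact_space_def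
proof (intro allI impI)
  fix \<U> assume \<U>: "(\<forall>U\<in>\<U>. openin T U) \<and> \<Union>\<U> = topspace T"
  have im: "\<phi> ` topspace T = S"
    using homeomorphic_imp_surjective_map[OF hom] by simp
  have op: "open (\<phi> ` U)" if "U \<in> \<U>" for U
    using \<U> that homeomorphic_map_openness_eq[OF hom] \<open>open S\<close> openin_open_eq by blast
  have pre: "openin T {x \<in> topspace T. \<phi> x \<in> V}" if "open V" for V
    using homeomorphic_imp_continuous_map[OF hom] that
    by (auto simp: continuous_map_in_subtopology intro: openin_continuous_map_preimage)
  have cov: "S \<subseteq> \<Union>((\<lambda>U. \<phi> ` U) ` \<U>)"
    using \<U> im by blast
  have op': "open V" if "V \<in> (\<lambda>U. \<phi> ` U) ` \<U>" for V
    using op that by blast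
  obtain \<C> where \<C>: "S \<subseteq> \<Union>\<C>"
      "\<And>V. V \<in> \<C> \<Longrightarrow> open V \<and> (\<exists>U. U \<in> (\<lambda>U. \<phi> ` U) ` \<U> \<and> V \<subseteq> U)"
      "\<And>x. x \<in> S \<Longrightarrow> \<exists>V. open V \<and> x \<in> V \<and> finite {U. U \<in> \<C> \<and> U \<inter> V \<noteq> {}}"
    by (rule paracompact[OF cov op'], assumption, rule that)
  define pb where "pb V = {x \<in> topspace T. \<phi> x \<in> V}" for V
  have inj: "inj_on \<phi> (topspace T)"
    by (rule homeomorphic_imp_injective_map[OF hom])
  have "openin T W \<and> (\<exists>U\<in>\<U>. W \<subseteq> U)" if "W \<in> pb ` \<C>" for W
  proof -
    from that obtain V where V: "V \<in> \<C>" "W = pb V" by blast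
    with \<C>(2) obtain U where U: "U \<in> \<U>" "V \<subseteq> \<phi> ` U" "open V" by blast
    have "U \<subseteq> topspace T" using U(1) \<U> by blast
    then have "W \<subseteq> U"
      using U(2) inj unfolding V(2) pb_def by (auto dest: inj_onD)
    then show ?thesis using U pre V(2) by (auto simp: pb_def)
  qed
  moreover have cover: "\<Union>(pb ` \<C>) = topspace T"
    using \<C>(1) im by (auto simp: pb_def)
  moreover have "locally_finite_in T (pb ` \<C>)"
    unfolding locally_finite_in_def
  proof (intro conjI ballI)
    fix x assume x: "x \<in> topspace T"
    then obtain V where V: "open V" "\<phi> x \<in> V" "finite {U \<in> \<C>. U \<inter> V \<noteq> {}}"
      using \<C>(3) im by blast
    have "{W \<in> pb ` \<C>. W \<inter> pb V \<noteq> {}} \<subseteq> pb ` {U \<in> \<C>. U \<inter> V \<noteq> {}}"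
      by (auto simp: pb_def)
    then have "finite {W \<in> pb ` \<C>. W \<inter> pb V \<noteq> {}}"
      using V(3) finite_surj by blast
    then show "\<exists>V. openin T V \<and> x \<in> V \<and> finite {W \<in> pb ` \<C>. W \<inter> V \<noteq> {}}"
      using pre[OF V(1)] V(2) x by (intro exI[of _ "pb V"]) (auto simp: pb_def)
  qed (use cover in auto)
  ultimately show "\<exists>\<V>. (\<forall>V\<in>\<V>. openin T V \<and> (\<exists>U\<in>\<U>. V \<subseteq> U)) \<and> \<Union>\<V> = topspace T \<and> locally_finite_in T \<V>"
    by (intro exI[of _ "pb ` \<C>"] conjI ballI) auto
qed

text \<open>Cauchy-Schwarz for the Hermitian pairing, with equality at \<open>z = p\<close> by
  \<open>sum_cnj_mult_self\<close>. Together they make pairing with a point a test function for the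
  hull.\<close>

lemma norm_sum_cnj_mult_le:
  fixes p z :: "complex^'n"
  shows "cmod (\<Sum>j\<in>UNIV. cnj (p $ j) * z $ j) \<le> norm p * norm z"
proof -
  have "cmod (\<Sum>j\<in>UNIV. cnj (p $ j) * z $ j) \<le> (\<Sum>j\<in>UNIV. \<bar>cmod (p $ j)\<bar> * \<bar>cmod (z $ j)\<bar>)"
    by (rule order_trans[OF norm_sum]) (simp add: norm_mult)
  also have "\<dots> \<le> norm p * norm z"
    unfolding norm_vec_def by (rule L2_set_mult_ineq)
  finally show ?thesis .
qed

lemma sum_cnj_mult_self:
  fixes p :: "complex^'n"
  shows "(\<Sum>j\<in>UNIV. cnj (p $ j) * p $ j) = of_real ((norm p)\<^sup>2)"
  by (simp add: norm_vec_def L2_set_def sum_nonneg complex_norm_square[simplified] mult.commute)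

text \<open>One chart covers the manifold, but the atlas may contain others, and notions tested on
  all charts have to be carried over by compatibility. Every region of the trisection is of this
  kind.\<close>

locale global_chart =
  fixes M :: "('p, complex^'n) charted_space" and \<phi> :: "'p \<Rightarrow> complex^'n"
  assumes manifold: "complex_manifold M"
    and chart: "(topspace (top_of M), \<phi>) \<in> charts M"
begin

abbreviation "X \<equiv> topspace (top_of M)"

lemma charts_is_chart: "c \<in> charts M \<Longrightarrow> is_chart (top_of M) c"
  using manifold by (simp add: complex_manifold_def)

lemma chart_subset: "(V, \<psi>) \<in> charts M \<Longrightarrow> V \<subseteq> X"
  using is_chartD(1)[OF charts_is_chart] openin_subset by blast

lemma compatible: "c \<in> charts M \<Longrightarrow> d \<in> charts M \<Longrightarrow> holomorphically_compatible c d"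
  using manifold by (simp add: complex_manifold_def)

lemma homeomorphic_chart: "homeomorphic_map (top_of M) (top_of_set (\<phi> ` X)) \<phi>"
  using is_chartD(3)[OF charts_is_chart[OF chart]] by simp

lemma inj_chart: "inj_on \<phi> X"
  using is_chartD(4)[OF charts_is_chart[OF chart]] .

lemma holomorphic_function_compose:
  assumes "holomorphic_fun_on (\<phi> ` X) g"
  shows "holomorphic_function M (\<lambda>p. g (\<phi> p))"
  unfolding holomorphic_function_def
proof clarify
  fix V \<psi> assume V: "(V, \<psi>) \<in> charts M"
  have "holomorphic_map_on (\<psi> ` V) (\<phi> \<circ> inv_into V \<psi>)"
    using compatible[OF chart V] chart_subset[OF V]
    by (simp add: holomorphically_compatible_def Int_absorb1)
  moreover have "(\<phi> \<circ> inv_into V \<psi>) ` \<psi> ` V \<subseteq> \<phi> ` X"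
    using chart_subset[OF V] inv_into_into[of _ \<psi> V] by fastforce
  ultimately show "holomorphic_fun_on (\<psi> ` V) ((\<lambda>p. g (\<phi> p)) \<circ> inv_into V \<psi>)"
    using holomorphic_fun_on_compose[OF _ assms] by (simp add: comp_def)
qed

lemma continuous_holomorphic_function:
  assumes "holomorphic_function M f"
  shows "continuous_map (top_of M) euclidean f"
proof -
  have "holomorphic_fun_on (\<phi> ` X) (f \<circ> inv_into X \<phi>)"
    using assms chart by (auto simp: holomorphic_function_def)
  then have "continuous_map (top_of_set (\<phi> ` X)) euclidean (f \<circ> inv_into X \<phi>)"
    using holomorphic_fun_on_continuous by (simp only: continuous_map_iff_continuous)
  then have "continuous_map (top_of M) euclidean ((f \<circ> inv_into X \<phi>) \<circ> \<phi>)"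
    using homeomorphic_imp_continuous_map[OF homeomorphic_chart] continuous_map_compose by blast
  then show ?thesis
    by (rule continuous_map_eq) (simp add: inj_chart)
qed

lemma separable: "holomorphically_separable M"
  unfolding holomorphically_separable_def
proof (intro ballI impI)
  fix p q assume "p \<in> X" "q \<in> X" "p \<noteq> q"
  then have "\<phi> p \<noteq> \<phi> q" using inj_chart by (auto dest: inj_onD)
  then obtain j where "\<phi> p $ j \<noteq> \<phi> q $ j" by (auto simp: vec_eq_iff)
  then show "\<exists>f. holomorphic_function M f \<and> f p \<noteq> f q"
    using holomorphic_function_compose[OF holomorphic_fun_on_vec_nth] by blast
qed

lemma local_coordinates: "global_local_coordinates M"
  unfolding global_local_coordinates_def
  using holomorphic_function_compose[OF holomorphic_fun_on_vec_nth] charts_is_chart[OF chart]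
    compatible[OF chart]
  by (intro ballI exI[of _ \<phi>] conjI exI[of _ X]) auto

text \<open>Testing against \<open>z \<mapsto> \<Sum> cnj p\<^sub>j z\<^sub>j\<close> shows that the hull of a set in a ball stays in the
  smallest concentric closed ball containing the set.\<close>

lemma convex:
  assumes ball: "\<phi> ` X = ball 0 r"
  shows "holomorphically_convex M"
  unfolding holomorphically_convex_def
proof (intro allI impI)
  fix K assume "compactin (top_of M) K \<and> K \<noteq> {}"
  then have K: "compactin (top_of M) K" "K \<noteq> {}" "K \<subseteq> X"
    using compactin_subset_topspace by auto
  let ?H = "holomorphic_hull M K"
  have hom: "homeomorphic_map (top_of M) (top_of_set (ball 0 r)) \<phi>"
    using homeomorphic_chart ball by simp
  have "compactin (top_of_set (ball 0 r)) (\<phi> ` K)"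
    using image_compactin[OF K(1) homeomorphic_imp_continuous_map[OF hom]] .
  then have "compact (\<phi> ` K)" by (simp add: compactin_subtopology)
  then obtain q where q: "q \<in> K" "\<And>k. k \<in> K \<Longrightarrow> norm (\<phi> k) \<le> norm (\<phi> q)"
    using continuous_attains_sup[of "\<phi> ` K" norm] K(2) by (auto intro: continuous_intros)
  \<comment> \<open>Strictness matters: the closed ball of this radius lies inside the open one, so
    its preimage \<open>C\<close> will be compact.\<close>
  have qr: "norm (\<phi> q) < r" using q(1) K(3) ball by force
  define C where "C = {p \<in> X. \<phi> p \<in> cball 0 (norm (\<phi> q))}"
  have "?H \<subseteq> C"
  proof
    fix p assume p: "p \<in> ?H"
    let ?g = "\<lambda>z. \<Sum>j\<in>UNIV. cnj (\<phi> p $ j) * z $ j"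
    have "holomorphic_function M (\<lambda>q. ?g (\<phi> q))"
      by (intro holomorphic_function_compose holomorphic_fun_on_sum holomorphic_fun_on_mult
          holomorphic_fun_on_const holomorphic_fun_on_vec_nth)
    then have "cmod (?g (\<phi> p)) \<le> (SUP k\<in>K. cmod (?g (\<phi> k)))"
      using p by (auto simp: holomorphic_hull_def)
    also have "\<dots> \<le> norm (\<phi> p) * norm (\<phi> q)"
      using q(2) by (intro cSUP_least[OF K(2)] order_trans[OF norm_sum_cnj_mult_le] mult_left_mono) auto
    finally have "norm (\<phi> p) * norm (\<phi> p) \<le> norm (\<phi> p) * norm (\<phi> q)"
      by (simp only: sum_cnj_mult_self norm_of_real abs_power2 power2_eq_square)
    \<comment> \<open>Trivial if \<open>\<phi> p\<close> is zero; otherwise the common factor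
      cancels.\<close>
    then have "norm (\<phi> p) \<le> norm (\<phi> q)"
      using norm_ge_zero[of "\<phi> p"] norm_ge_zero[of "\<phi> q"] by (metis dual_order.order_iff_strict mult_le_cancel_left_pos)
    then show "p \<in> C" using p by (auto simp: C_def holomorphic_hull_def)
  qed
  moreover have "compactin (top_of M) C"
  proof -
    obtain g where g: "homeomorphic_maps (top_of M) (top_of_set (ball 0 r)) \<phi> g"
      using hom homeomorphic_map_maps by blast
    have "compactin (top_of_set (ball 0 r)) (cball (0 :: complex^'n) (norm (\<phi> q)))"
      using qr by (auto simp: compactin_subtopology)
    then have "compactin (top_of M) (g ` cball 0 (norm (\<phi> q)))"
      using g image_compactin by (auto simp: homeomorphic_maps_def)
    moreover have "g ` cball 0 (norm (\<phi> q)) = C"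
    proof -
      have gz: "g z \<in> X" "\<phi> (g z) = z" if "norm z < r" for z
        using g that by (auto simp: homeomorphic_maps_def continuous_map_def Pi_iff)
      have gp: "g (\<phi> p) = p" if "p \<in> X" for p
        using g that by (auto simp: homeomorphic_maps_def)
      show ?thesis
        using gz gp qr by (force simp: C_def image_iff)
    qed
    ultimately show ?thesis by simp
  qed
  \<comment> \<open>Continuity of the holomorphic functions makes the hull closed; inside the
    compact set \<open>C\<close> this gives compactness.\<close>
  moreover have "closedin (top_of M) ?H"
  proof -
    have "?H = X \<inter> \<Inter>((\<lambda>f. {p \<in> X. f p \<in> cball 0 (SUP q\<in>K. cmod (f q))}) ` {f. holomorphic_function M f})"
      by (auto simp: holomorphic_hull_def)
    moreover have "closedin (top_of M) {p \<in> X. f p \<in> cball 0 (SUP q\<in>K. cmod (f q))}"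
      if "holomorphic_function M f" for f
      using closedin_continuous_map_preimage[OF continuous_holomorphic_function[OF that],
          of "cball 0 (SUP q\<in>K. cmod (f q))"] by simp
    \<comment> \<open>\<open>closedin_Inter\<close> requires a nonempty family.\<close>
    moreover have "{f. holomorphic_function M f} \<noteq> {}"
      using holomorphic_function_compose[OF holomorphic_fun_on_const[of _ 0]] by blast
    ultimately show ?thesis
      by (auto intro!: closedin_Int closedin_Inter)
  qed
  ultimately show "compactin (top_of M) ?H"
    by (blast intro: closed_compactin)
qed

lemma Stein_ball:
  assumes "\<phi> ` X = ball 0 r"
  shows "Stein M"
proof -
  have "paracompact_space (top_of M)"
    by (rule paracompact_space_homeomorphic[OF homeomorphic_chart]) (simp add: assms)
  then show ?thesis
    using manifold convex[OF assms] separable local_coordinates by (simp add: Stein_def)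
qed

text \<open>The maps are given in the global chart. \<open>S\<close> may fail to be open, so
  \<open>G\<close> is smooth on an open \<open>W\<close> around it. Smoothness of chart changes is a
  hypothesis because \<open>holomorphic_fun_on\<close> supplies one derivative only; for the
  projective plane the changes are rational and can be checked directly.\<close>

lemma diffeomorphic_toI:
  assumes transition: "\<And>V \<psi>. (V, \<psi>) \<in> charts M \<Longrightarrow> Cinf_on (\<phi> \<circ> inv_into V \<psi>) (\<psi> ` V)"
      "\<And>V \<psi>. (V, \<psi>) \<in> charts M \<Longrightarrow> Cinf_on (\<psi> \<circ> inv_into X \<phi>) (\<phi> ` V)"
    and F: "Cinf_on F (\<phi> ` X)" and G: "Cinf_on G W" and W: "S \<subseteq> W"
    and FS: "\<And>x. x \<in> \<phi> ` X \<Longrightarrow> F x \<in> S \<and> G (F x) = x"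
    and GS: "\<And>y. y \<in> S \<Longrightarrow> G y \<in> \<phi> ` X \<and> F (G y) = y"
  shows "diffeomorphic_to M S"
  unfolding diffeomorphic_to_def
proof (intro exI[of _ "F \<circ> \<phi>"] conjI)
  have "homeomorphic_maps (top_of_set (\<phi> ` X)) (top_of_set S) F G"
    unfolding homeomorphic_maps_def
    using Cinf_on_continuous[OF F] continuous_on_subset[OF Cinf_on_continuous[OF G] W] FS GS
    by (auto simp: continuous_map_in_subtopology)
  then show hom: "homeomorphic_map (top_of M) (top_of_set S) (F \<circ> \<phi>)"
    using homeomorphic_chart homeomorphic_map_compose homeomorphic_map_maps by blast
  have inj: "inj_on (F \<circ> \<phi>) X"
    using homeomorphic_imp_injective_map[OF hom] .
  show "\<forall>(V, \<psi>)\<in>charts M. smooth_on (\<psi> ` V) (F \<circ> \<phi> \<circ> inv_into V \<psi>) \<and>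
      smooth_on ((F \<circ> \<phi>) ` V) (\<psi> \<circ> inv_into X (F \<circ> \<phi>))"
  proof (clarify, intro conjI)
    fix V \<psi> assume V: "(V, \<psi>) \<in> charts M"
    have "(\<phi> \<circ> inv_into V \<psi>) ` \<psi> ` V \<subseteq> \<phi> ` X"
      using chart_subset[OF V] inv_into_into[of _ \<psi> V] by fastforce
    then show "smooth_on (\<psi> ` V) (F \<circ> \<phi> \<circ> inv_into V \<psi>)"
      by (intro Cinf_on_imp_smooth_on[OF Cinf_on_compose[OF F transition(1)[OF V]]]) auto
    let ?W = "W \<inter> G -` (\<phi> ` V)"
    have "open ?W"
      using continuous_open_preimage[OF Cinf_on_continuous[OF G] Cinf_on_open[OF G]]
        Cinf_on_open[OF transition(2)[OF V]] by blast
    then have "Cinf_on (\<lambda>y. (\<psi> \<circ> inv_into X \<phi>) (G y)) ?W"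
      by (intro Cinf_on_compose[OF transition(2)[OF V]] Cinf_on_subset[OF G]) auto
    then show "smooth_on ((F \<circ> \<phi>) ` V) (\<psi> \<circ> inv_into X (F \<circ> \<phi>))"
    proof (rule Cinf_on_imp_smooth_on)
      show "(F \<circ> \<phi>) ` V \<subseteq> ?W"
        using FS W chart_subset[OF V] by auto
      fix y assume "y \<in> (F \<circ> \<phi>) ` V"
      then obtain p where p: "p \<in> V" "p \<in> X" "y = (F \<circ> \<phi>) p"
        using chart_subset[OF V] by auto
      then show "(\<psi> \<circ> inv_into X \<phi>) (G y) = (\<psi> \<circ> inv_into X (F \<circ> \<phi>)) y"
        using inv_into_f_f[OF inj p(2)] inv_into_f_f[OF inj_chart p(2)] FS by simp
    qed
  qed
qed

end

section \<open>The projective plane as a complex manifold\<close>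

lemma index_3: "i \<noteq> i + 1" "i \<noteq> i + 2" "i + 1 \<noteq> i + 2" "i + 1 + 1 = i + 2" "i + 1 + 2 = i"
    "i + 2 + 1 = i" "i + 2 + 2 = i + 1" "j = i \<or> j = i + 1 \<or> j = i + 2" for i j :: 3
  using exhaust_3[of i] exhaust_3[of j] by auto

lemma UNIV_3_cyclic: "UNIV = {i, i + 1, i + 2 :: 3}"
  using index_3(8) by auto

text \<open>The representative with \<open>i\<close>-th coordinate 1; after taking spans it inverts
  the \<open>i\<close>-th affine chart.\<close>

definition homog :: "3 \<Rightarrow> complex^2 \<Rightarrow> complex^3" where
  "homog i w = (\<chi> j. if j = i then 1 else if j = i + 1 then w $ 1 else w $ 2)"

lemma homog_nth [simp]: "homog i w $ i = 1" "homog i w $ (i + 1) = w $ 1" "homog i w $ (i + 2) = w $ 2"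
  using index_3[of i] by (simp_all add: homog_def)

lemma homog_nonzero [simp]: "homog i w \<noteq> 0"
  using homog_nth(1)[of i w] by (metis zero_index zero_neq_one)

lemma homog_eqI:
  assumes "v $ i \<noteq> 0"
  shows "homog i (vector [v $ (i + 1) / v $ i, v $ (i + 2) / v $ i]) = (1 / v $ i) *s v"
  using assms index_3[of i] index_3(8)[of _ i] by (auto simp: vec_eq_iff homog_def)

lemma span_scale:
  assumes "c \<noteq> 0"
  shows "vec.span {c *s v} = vec.span {v :: complex^3}"
  unfolding vec.span_singleton
proof (intro equalityI subsetI)
  fix x assume "x \<in> range (\<lambda>k. k *s v)"
  then obtain k where "x = k *s v" by blast
  then have "x = (k / c) *s (c *s v)"
    using assms by (simp add: vector_smult_assoc)
  then show "x \<in> range (\<lambda>k. k *s (c *s v))" by (rule range_eqI)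
qed (auto simp: vector_smult_assoc)

lemma mem_CP2_points: "v \<noteq> 0 \<Longrightarrow> vec.span {v} \<in> CP2_points"
  by (auto simp: CP2_points_def)

lemma CP2_pointsE:
  assumes "L \<in> CP2_points"
  obtains v where "v \<noteq> 0" "L = vec.span {v}"
  using assms by (auto simp: CP2_points_def)

lemma span_mem_affine_domain [simp]:
  assumes "v \<noteq> 0"
  shows "vec.span {v} \<in> CP2_affine_domain i \<longleftrightarrow> v $ i \<noteq> 0"
proof -
  have "(\<exists>u\<in>vec.span {v}. u $ i \<noteq> 0) \<longleftrightarrow> v $ i \<noteq> 0"
    by (auto simp: vec.span_singleton intro: exI[of _ 1])
  then show ?thesis
    using assms by (simp add: CP2_affine_domain_def mem_CP2_points)
qed

lemma span_mem_affine_domainI [simp]: "v $ i \<noteq> 0 \<Longrightarrow> vec.span {v} \<in> CP2_affine_domain i"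
  using span_mem_affine_domain[of v i] by fastforce

lemma CP2_affine_domainE:
  assumes "L \<in> CP2_affine_domain i"
  obtains w where "L = vec.span {homog i w}"
proof -
  obtain v where v: "v \<noteq> 0" "L = vec.span {v}"
    using assms CP2_pointsE by (auto simp: CP2_affine_domain_def)
  then have "v $ i \<noteq> 0" using assms by simp
  then show ?thesis
    using that[of "vector [v $ (i + 1) / v $ i, v $ (i + 2) / v $ i]"] v by (simp add: homog_eqI span_scale)
qed

lemma CP2_affine_coords_homog [simp]: "CP2_affine_coords i (vec.span {homog i w}) = w"
  by (simp add: CP2_affine_coords_span vec_eq_iff forall_2)

lemma affine_coords_image:
  assumes "S \<subseteq> CP2_affine_domain i"
  shows "CP2_affine_coords i ` S = {w. vec.span {homog i w} \<in> S}"
  using assms by (force elim: CP2_affine_domainE)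

lemma inj_on_affine_coords: "inj_on (CP2_affine_coords i) (CP2_affine_domain i)"
  by (auto intro!: inj_onI elim!: CP2_affine_domainE)

lemma inv_into_affine_coords:
  assumes "S \<subseteq> CP2_affine_domain i" "vec.span {homog i w} \<in> S"
  shows "inv_into S (CP2_affine_coords i) w = vec.span {homog i w}"
  using inv_into_f_f[OF inj_on_subset[OF inj_on_affine_coords assms(1)] assms(2)] by simp

text \<open>Chart changes as explicit quotients, from which both holomorphy and smoothness are read
  off.\<close>

definition transition :: "3 \<Rightarrow> 3 \<Rightarrow> complex^2 \<Rightarrow> complex^2" where
  "transition i j w =
     vector [homog i w $ (j + 1) / homog i w $ j, homog i w $ (j + 2) / homog i w $ j]"

lemma transition_eq:
  "homog i w $ j \<noteq> 0 \<Longrightarrow> CP2_affine_coords j (vec.span {homog i w}) = transition i j w"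
  by (simp add: CP2_affine_coords_span transition_def)

lemma homog_nth_cases:
  "(\<lambda>w. homog i w $ j) = (\<lambda>w. 1) \<or> (\<lambda>w. homog i w $ j) = (\<lambda>w. w $ 1) \<or>
   (\<lambda>w. homog i w $ j) = (\<lambda>w. w $ 2)"
  by (cases "j = i"; cases "j = i + 1") (auto simp: homog_def)

lemma holomorphic_homog: "holomorphic_fun_on S (\<lambda>w. homog i w $ j)"
  using homog_nth_cases[of i j] by (auto simp: holomorphic_fun_on_const holomorphic_fun_on_vec_nth)

lemma Cinf_on_homog: "open S \<Longrightarrow> Cinf_on (\<lambda>w. homog i w $ j) S"
  using homog_nth_cases[of i j] by (auto simp: Cinf_on_const Cinf_on_vec_nth)

lemma continuous_on_homog: "continuous_on S (homog i)"
proof -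
  have "continuous_on S (\<lambda>w. homog i w $ j)" for j
    using homog_nth_cases[of i j] by (elim disjE; simp only:) (auto intro: continuous_intros)
  then have "continuous_on S (\<lambda>w. \<chi> j. homog i w $ j)"
    by (rule continuous_on_vec_lambda)
  then show ?thesis by simp
qed

lemma holomorphic_transition: "holomorphic_map_on {w. homog i w $ j \<noteq> 0} (transition i j)"
  unfolding holomorphic_map_on_def
proof
  fix k :: 2
  show "holomorphic_fun_on {w. homog i w $ j \<noteq> 0} (\<lambda>w. transition i j w $ k)"
    using exhaust_2[of k]
    by (auto simp: transition_def intro!: holomorphic_fun_on_divide holomorphic_homog)
qed

lemma Cinf_on_transition: "Cinf_on (transition i j) {w. homog i w $ j \<noteq> 0}"
proof -
  have "open {w. homog i w $ j \<noteq> 0}"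
    using continuous_on_homog[of UNIV i] by (intro open_Collect_neq continuous_intros)
  then show ?thesis
    unfolding transition_def
    by (intro Cinf_on_vector_2 Cinf_on_divide_complex Cinf_on_homog) auto
qed

text \<open>Two sets occur because \<open>inv_into\<close> refers to \<open>S\<close> while
  smoothness is wanted on \<open>V\<close>. Both directions of a chart change on a region are
  instances, one of them with \<open>S = V\<close>.\<close>

lemma Cinf_on_affine_transition:
  assumes S: "S \<subseteq> CP2_affine_domain i" and V: "V \<subseteq> S" "V \<subseteq> CP2_affine_domain j"
    and "open (CP2_affine_coords i ` V)"
  shows "Cinf_on (CP2_affine_coords j \<circ> inv_into S (CP2_affine_coords i)) (CP2_affine_coords i ` V)"
proof (rule Cinf_on_cong)
  have im: "CP2_affine_coords i ` V = {w. vec.span {homog i w} \<in> V}"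
    using S V by (intro affine_coords_image) auto
  have nz: "homog i w $ j \<noteq> 0" if "vec.span {homog i w} \<in> V" for w
    using that V(2) by (metis homog_nonzero span_mem_affine_domain subsetD)
  show "Cinf_on (transition i j) (CP2_affine_coords i ` V)"
    using assms(4) nz im by (intro Cinf_on_subset[OF Cinf_on_transition]) auto
  show "transition i j w = (CP2_affine_coords j \<circ> inv_into S (CP2_affine_coords i)) w"
    if "w \<in> CP2_affine_coords i ` V" for w
    using that im nz V(1) by (auto simp: inv_into_affine_coords[OF S] transition_eq subset_iff)
qed

text \<open>By definition of the quotient topology, the preimage of an open set of lines is the
  preimage under \<open>f\<close> of an open set of vectors.\<close>

lemma continuous_map_CP2_quotient:
  assumes "continuous_on S f" "\<And>x. x \<in> S \<Longrightarrow> f x \<noteq> 0" "open S"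
  shows "continuous_map (top_of_set S) CP2_topology (\<lambda>x. vec.span {f x})"
  unfolding continuous_map_def
proof (intro conjI allI impI)
  show "(\<lambda>x. vec.span {f x}) \<in> topspace (top_of_set S) \<rightarrow> topspace CP2_topology"
    using topspace_CP2 assms(2) by (auto simp: CP2_def intro: mem_CP2_points)
  fix U assume "openin CP2_topology U"
  then have "open {v. v \<noteq> 0 \<and> vec.span {v} \<in> U}"
    by (simp add: openin_CP2_topology)
  then have "open (S \<inter> f -` {v. v \<noteq> 0 \<and> vec.span {v} \<in> U})"
    using assms continuous_open_preimage by blast
  moreover have "{x \<in> topspace (top_of_set S). vec.span {f x} \<in> U} = S \<inter> f -` {v. v \<noteq> 0 \<and> vec.span {v} \<in> U}"
    using assms(2) by auto
  ultimately show "openin (top_of_set S) {x \<in> topspace (top_of_set S). vec.span {f x} \<in> U}"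
    using openin_open_Int[of "S \<inter> f -` {v. v \<noteq> 0 \<and> vec.span {v} \<in> U}" S] by simp
qed

lemma openin_affine_domain: "openin CP2_topology (CP2_affine_domain i)"
proof -
  have "{v. v \<noteq> 0 \<and> vec.span {v} \<in> CP2_affine_domain i} = {v. v $ i \<noteq> 0}"
    by auto
  moreover have "open {v :: complex^3. v $ i \<noteq> 0}"
    by (intro open_Collect_neq continuous_intros)
  ultimately show ?thesis
    by (auto simp: openin_CP2_topology CP2_affine_domain_def)
qed

lemma is_chart_CP2: "is_chart CP2_topology (CP2_affine_domain i, CP2_affine_coords i)"
proof -
  let ?D = "CP2_affine_domain i" and ?c = "CP2_affine_coords i"
  have im: "?c ` ?D = UNIV"
    by (simp add: affine_coords_image)
  have "homeomorphic_maps (subtopology CP2_topology ?D) (top_of_set UNIV) ?c (\<lambda>w. vec.span {homog i w})"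
    unfolding homeomorphic_maps_def
  proof (intro conjI)
    show "continuous_map (subtopology CP2_topology ?D) (top_of_set UNIV) ?c"
      unfolding subtopology_UNIV continuous_map_def
    proof (intro conjI allI impI)
      fix U :: "(complex^2) set" assume "openin euclidean U"
      then have U: "open U" by simp
      \<comment> \<open>Continuity on the quotient is tested on vectors, where the chart is this
        explicit formula.\<close>
      let ?g = "\<lambda>v. vector [v $ (i + 1) / v $ i, v $ (i + 2) / v $ i] :: complex^2"
      have op: "open {v::complex^3. v $ i \<noteq> 0}"
        by (intro open_Collect_neq continuous_intros)
      have "continuous_on {v. v $ i \<noteq> 0} ?g"
        by (intro Cinf_on_continuous Cinf_on_intros op) auto
      then have "open ({v. v $ i \<noteq> 0} \<inter> ?g -` U)"
        using op U continuous_open_preimage by blast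
      moreover have "{v. v \<noteq> 0 \<and> vec.span {v} \<in> {L \<in> ?D. ?c L \<in> U}} = {v. v $ i \<noteq> 0} \<inter> ?g -` U"
        by (auto simp: CP2_affine_coords_span)
      ultimately have "openin CP2_topology {L \<in> ?D. ?c L \<in> U}"
        by (auto simp: openin_CP2_topology CP2_affine_domain_def)
      moreover have "{L \<in> topspace (subtopology CP2_topology ?D). ?c L \<in> U} = {L \<in> ?D. ?c L \<in> U}"
        using openin_subset[OF openin_affine_domain[of i]] by auto
      ultimately show "openin (subtopology CP2_topology ?D)
          {L \<in> topspace (subtopology CP2_topology ?D). ?c L \<in> U}"
        using openin_affine_domain[of i] by (simp add: openin_open_subtopology)
    qed simp
    have "continuous_map euclidean CP2_topology (\<lambda>w. vec.span {homog i w})"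
      using continuous_map_CP2_quotient[of UNIV "homog i"] continuous_on_homog by simp
    then show "continuous_map (top_of_set UNIV) (subtopology CP2_topology ?D) (\<lambda>w. vec.span {homog i w})"
      by (auto simp: continuous_map_in_subtopology)
  qed (auto elim: CP2_affine_domainE)
  then have "homeomorphic_map (subtopology CP2_topology ?D) (top_of_set UNIV) ?c"
    using homeomorphic_map_maps by blast
  then show ?thesis
    using openin_affine_domain by (simp add: is_chart_def im)
qed

lemma compatible_CP2:
  "holomorphically_compatible (CP2_affine_domain i, CP2_affine_coords i)
     (CP2_affine_domain j, CP2_affine_coords j)"
proof -
  have "holomorphic_map_on (CP2_affine_coords i ` (CP2_affine_domain i \<inter> CP2_affine_domain j))
      (CP2_affine_coords j \<circ> inv_into (CP2_affine_domain i) (CP2_affine_coords i))" for i j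
  proof (rule holomorphic_map_on_cong)
    have im: "CP2_affine_coords i ` (CP2_affine_domain i \<inter> CP2_affine_domain j) = {w. homog i w $ j \<noteq> 0}"
      by (simp add: affine_coords_image)
    show "open (CP2_affine_coords i ` (CP2_affine_domain i \<inter> CP2_affine_domain j))"
      unfolding im using Cinf_on_open[OF Cinf_on_transition] .
    show "holomorphic_map_on (CP2_affine_coords i ` (CP2_affine_domain i \<inter> CP2_affine_domain j)) (transition i j)"
      unfolding im by (rule holomorphic_transition)
    show "transition i j w = (CP2_affine_coords j \<circ> inv_into (CP2_affine_domain i) (CP2_affine_coords i)) w"
      if "w \<in> CP2_affine_coords i ` (CP2_affine_domain i \<inter> CP2_affine_domain j)" for w
      using that unfolding im by (simp add: inv_into_affine_coords transition_eq)
  qed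
  from this[of i j] this[of j i] show ?thesis
    by (simp add: holomorphically_compatible_def Int_commute)
qed

text \<open>The orthogonal projection onto the line spanned by \<open>v\<close> depends continuously on the line and
  determines it, so it separates the points of the projective plane.\<close>

definition projection_matrix :: "complex^3 \<Rightarrow> complex^3^3" where
  "projection_matrix v = (\<chi> i j. v $ i * cnj (v $ j) / of_real ((norm v)\<^sup>2))"

lemma norm_smult: "norm (c *s v) = cmod c * norm v" for v :: "complex^3"
  by (simp add: norm_vec_def L2_set_def norm_mult power_mult_distrib real_sqrt_mult flip: sum_distrib_left)

lemma projection_matrix_smult:
  assumes "c \<noteq> 0"
  shows "projection_matrix (c *s v) = projection_matrix v"
proof -
  have "c * cnj c \<noteq> 0" using assms by simp
  then have "(c * a) * (cnj c * b) / ((c * cnj c) * d) = a * b / d" for a b d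
    by (simp add: field_simps)
  then show ?thesis
    by (simp add: projection_matrix_def norm_smult vec_eq_iff power_mult_distrib complex_norm_square[simplified])
qed

text \<open>Each column of the matrix is a multiple of the vector. Column \<open>j\<close> is chosen
  nonzero for \<open>w\<close>; equality of the columns then makes both multiples nonzero.\<close>

lemma projection_matrix_eqD:
  assumes "v \<noteq> 0" "w \<noteq> 0" "projection_matrix v = projection_matrix w"
  shows "vec.span {v} = vec.span {w}"
proof -
  obtain j where j: "w $ j \<noteq> 0" using assms(2) by (auto simp: vec_eq_iff)
  define a where "a = cnj (v $ j) / of_real ((norm v)\<^sup>2)"
  define b where "b = cnj (w $ j) / of_real ((norm w)\<^sup>2)"
  have "v $ i * a = w $ i * b" for i
    using assms(3) by (simp add: projection_matrix_def vec_eq_iff a_def b_def)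
  then have eq: "a *s v = b *s w" by (simp add: vec_eq_iff mult.commute)
  have "b \<noteq> 0" using j assms(2) by (simp add: b_def)
  moreover have "a \<noteq> 0"
  proof
    assume "a = 0"
    with eq \<open>b \<noteq> 0\<close> assms(2) show False by simp
  qed
  ultimately show ?thesis
    using eq span_scale by metis
qed

lemma Hausdorff_CP2: "Hausdorff_space CP2_topology"
proof -
  have top: "topspace CP2_topology = CP2_points"
    using topspace_CP2 by (simp add: CP2_def)
  \<comment> \<open>A representative is chosen here; \<open>projection_matrix_smult\<close> makes
    the choice immaterial.\<close>
  define P where "P L = projection_matrix (SOME v. v \<noteq> 0 \<and> L = vec.span {v})" for L
  have P: "P (vec.span {v}) = projection_matrix v" if "v \<noteq> 0" for v
  proof -
    define w where "w = (SOME w. w \<noteq> 0 \<and> vec.span {v} = vec.span {w})"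
    have w: "w \<noteq> 0" "vec.span {v} = vec.span {w}"
      using someI[of "\<lambda>w. w \<noteq> 0 \<and> vec.span {v} = vec.span {w}" v] that by (auto simp: w_def)
    then obtain c where "w = c *s v"
      using vec.span_base[of w "{w}"] by (auto simp: vec.span_singleton)
    moreover from this w(1) have "c \<noteq> 0" by auto
    ultimately show ?thesis
      by (simp add: P_def projection_matrix_smult flip: w_def)
  qed
  have cont: "continuous_on (- {0}) projection_matrix"
    unfolding projection_matrix_def by (intro continuous_intros continuous_on_vec_lambda) auto
  have "continuous_map CP2_topology euclidean P"
    unfolding continuous_map_def top
  proof (intro conjI allI impI)
    fix U :: "(complex^3^3) set" assume "openin euclidean U"
    then have "open (- {0} \<inter> projection_matrix -` U)"
      using cont by (intro continuous_open_preimage) auto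
    moreover have "{v. v \<noteq> 0 \<and> vec.span {v} \<in> {L \<in> CP2_points. P L \<in> U}} = - {0} \<inter> projection_matrix -` U"
      by (auto simp: P mem_CP2_points)
    ultimately show "openin CP2_topology {L \<in> CP2_points. P L \<in> U}"
      by (auto simp: openin_CP2_topology)
  qed simp
  moreover have "inj_on P CP2_points"
    by (intro inj_onI) (metis CP2_pointsE P projection_matrix_eqD)
  ultimately show ?thesis
    using Hausdorff_space_injective_preimage[OF Hausdorff_space_euclidean] top by metis
qed

section \<open>Second countability of the projective plane\<close>

lemma second_countable_euclidean:
  "second_countable (euclidean :: 'a::second_countable_topology topology)"
proof -
  obtain \<B> :: "'a set set" where \<B>: "countable \<B>" "\<And>C. C \<in> \<B> \<Longrightarrow> open C"
      "\<And>S. open S \<Longrightarrow> \<exists>U. U \<subseteq> \<B> \<and> S = \<Union>U"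
    by (rule univ_second_countable) blast
  have "\<exists>V\<in>\<B>. x \<in> V \<and> V \<subseteq> S" if "open S" "x \<in> S" for S x
    using \<B>(3)[OF that(1)] that(2) by blast
  then show ?thesis
    unfolding second_countable_def using \<B>(1,2) by (intro exI[of _ \<B>]) auto
qed

text \<open>The projection from the nonzero vectors is a continuous open surjection and so carries a
  countable base over.\<close>

lemma second_countable_CP2: "second_countable CP2_topology"
proof (rule second_countable_open_map_image)
  have top: "topspace CP2_topology = CP2_points"
    using topspace_CP2 by (simp add: CP2_def)
  let ?q = "\<lambda>v :: complex^3. vec.span {v}"
  show "continuous_map (top_of_set (- {0})) CP2_topology ?q"
    by (intro continuous_map_CP2_quotient) (auto intro: continuous_intros)
  show "?q ` topspace (top_of_set (- {0})) = topspace CP2_topology"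
    by (auto simp: top CP2_points_def)
  show "second_countable (top_of_set (- {0} :: (complex^3) set))"
    by (intro second_countable_subtopology second_countable_euclidean)
  show "open_map (top_of_set (- {0})) CP2_topology ?q"
    unfolding open_map_def
  proof (intro allI impI)
    fix U :: "(complex^3) set" assume "openin (top_of_set (- {0})) U"
    then have U: "open U" "U \<subseteq> - {0}"
      using openin_open_eq[of "- {0} :: (complex^3) set"] by (auto simp: open_Compl)
    \<comment> \<open>The vectors on lines that meet \<open>U\<close> are those some nonzero
      multiple of which lies in \<open>U\<close>: a union of preimages of \<open>U\<close> under
      scalings, each open.\<close>
    have "{v. v \<noteq> 0 \<and> ?q v \<in> ?q ` U} = (\<Union>c\<in>- {0}. (\<lambda>v. c *s v) -` U)"
    proof (intro equalityI subsetI)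
      fix v assume "v \<in> {v. v \<noteq> 0 \<and> ?q v \<in> ?q ` U}"
      then obtain u where u: "v \<noteq> 0" "u \<in> U" "?q v = ?q u" by auto
      then obtain c where "u = c *s v"
        using vec.span_base[of u "{u}"] by (auto simp: vec.span_singleton)
      then show "v \<in> (\<Union>c\<in>- {0}. (\<lambda>v. c *s v) -` U)"
        using u U(2) by (auto intro!: bexI[of _ c])
    next
      fix v assume "v \<in> (\<Union>c\<in>- {0}. (\<lambda>v. c *s v) -` U)"
      then obtain c where "c \<noteq> 0" "c *s v \<in> U" by auto
      then show "v \<in> {v. v \<noteq> 0 \<and> ?q v \<in> ?q ` U}"
        using U(2) span_scale[of c v] by (auto intro!: image_eqI[of _ _ "c *s v"])
    qed
    moreover have "open ((\<lambda>v :: complex^3. c *s v) -` U)" for c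
    proof -
      have "continuous_on UNIV (\<lambda>v :: complex^3. c *s v)"
        unfolding vector_scalar_mult_def by (intro continuous_on_vec_lambda continuous_intros)
      then show ?thesis using U(1) by (simp add: open_vimage)
    qed
    ultimately show "openin CP2_topology (?q ` U)"
      using U(2) by (auto simp: openin_CP2_topology intro!: mem_CP2_points)
  qed
qed

lemma complex_manifold_CP2: "complex_manifold CP2"
  unfolding complex_manifold_def topspace_CP2
proof (intro conjI)
  have "\<exists>i. L \<in> CP2_affine_domain i" if "L \<in> CP2_points" for L
    using that by (auto elim!: CP2_pointsE simp: vec_eq_iff)
  then show "(\<Union>(U, \<phi>)\<in>charts CP2. U) = CP2_points"
    by (auto simp: CP2_def CP2_affine_domain_def)
qed (auto simp: CP2_def Hausdorff_CP2 second_countable_CP2 is_chart_CP2 compatible_CP2)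

section \<open>Regions inside one affine chart\<close>

lemma global_chart_CP2:
  assumes "openin CP2_topology Z" "Z \<subseteq> CP2_affine_domain i"
  shows "global_chart (open_submanifold CP2 Z) (CP2_affine_coords i)"
    and "topspace (top_of (open_submanifold CP2 Z)) = Z"
proof -
  show top: "topspace (top_of (open_submanifold CP2 Z)) = Z"
    using openin_subset[OF assms(1)] by (auto simp: open_submanifold_def CP2_def)
  have "(CP2_affine_domain i \<inter> Z, CP2_affine_coords i) \<in> charts (open_submanifold CP2 Z)"
    by (force simp: open_submanifold_def CP2_def)
  moreover have "CP2_affine_domain i \<inter> Z = Z" using assms(2) by blast
  ultimately show "global_chart (open_submanifold CP2 Z) (CP2_affine_coords i)"
    using complex_manifold_open_submanifold[OF complex_manifold_CP2, of Z] assms(1) top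
    by unfold_locales (simp_all add: CP2_def)
qed

text \<open>Settles all questions about charts: for each region only a smooth map and its inverse,
  in one affine chart, remain to be given.\<close>

lemma diffeomorphic_to_CP2I:
  assumes Z: "openin CP2_topology Z" "Z \<subseteq> CP2_affine_domain i"
    and F: "Cinf_on F (CP2_affine_coords i ` Z)" and G: "Cinf_on G W" and W: "S \<subseteq> W"
    and FS: "\<And>x. x \<in> CP2_affine_coords i ` Z \<Longrightarrow> F x \<in> S \<and> G (F x) = x"
    and GS: "\<And>y. y \<in> S \<Longrightarrow> G y \<in> CP2_affine_coords i ` Z \<and> F (G y) = y"
  shows "diffeomorphic_to (open_submanifold CP2 Z) S"
proof (rule global_chart.diffeomorphic_toI[OF global_chart_CP2(1)[OF Z]],
    unfold global_chart_CP2(2)[OF Z])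
  fix V \<psi> assume "(V, \<psi>) \<in> charts (open_submanifold CP2 Z)"
  then obtain j where V: "V = CP2_affine_domain j \<inter> Z" "\<psi> = CP2_affine_coords j"
    by (auto simp: open_submanifold_def CP2_def)
  have sub: "V \<subseteq> CP2_affine_domain j" "V \<subseteq> CP2_affine_domain i" "V \<subseteq> Z"
    using V(1) Z(2) by auto
  have "openin CP2_topology V"
    using V(1) Z(1) openin_affine_domain by blast
  then have "open (CP2_affine_coords k ` V)" if "V \<subseteq> CP2_affine_domain k" for k
    using is_chart_open_image[OF is_chart_CP2] that by blast
  then show "Cinf_on (CP2_affine_coords i \<circ> inv_into V \<psi>) (\<psi> ` V)"
    and "Cinf_on (\<psi> \<circ> inv_into Z (CP2_affine_coords i)) (CP2_affine_coords i ` V)"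
    unfolding V(2) using sub Z(2) by (auto intro!: Cinf_on_affine_transition)
qed (use assms in auto)

section \<open>The trisection\<close>

definition sector :: "3 \<Rightarrow> (complex^3) set set" where
  "sector i = {vec.span {v} |v.
     (cmod (v $ (i + 1)))\<^sup>2 + (cmod (v $ (i + 2)))\<^sup>2 < 5 * (cmod (v $ i))\<^sup>2}"

lemma sector_nonzero:
  fixes v :: "complex^3"
  assumes "(cmod (v $ (i + 1)))\<^sup>2 + (cmod (v $ (i + 2)))\<^sup>2 < 5 * (cmod (v $ i))\<^sup>2"
  shows "v $ i \<noteq> 0"
proof
  assume "v $ i = 0"
  then show False
    using assms zero_le_power2[of "cmod (v $ (i + 1))"] zero_le_power2[of "cmod (v $ (i + 2))"]
    by simp
qed

text \<open>Passing to the multiple by \<open>c\<close> scales both sides by the squared modulus of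
  \<open>c\<close>, so the inequality is a property of the line.\<close>

lemma span_mem_sector:
  assumes "v \<noteq> 0"
  shows "vec.span {v} \<in> sector i \<longleftrightarrow>
    (cmod (v $ (i + 1)))\<^sup>2 + (cmod (v $ (i + 2)))\<^sup>2 < 5 * (cmod (v $ i))\<^sup>2"
proof
  assume "vec.span {v} \<in> sector i"
  then obtain u where u: "vec.span {v} = vec.span {u}"
      "(cmod (u $ (i + 1)))\<^sup>2 + (cmod (u $ (i + 2)))\<^sup>2 < 5 * (cmod (u $ i))\<^sup>2"
    by (auto simp: sector_def)
  obtain c where c: "u = c *s v"
    using u(1) vec.span_base[of u "{u}"] by (auto simp: vec.span_singleton)
  have "c \<noteq> 0" using c sector_nonzero[OF u(2)] by auto
  have "(cmod c)\<^sup>2 * ((cmod (v $ (i + 1)))\<^sup>2 + (cmod (v $ (i + 2)))\<^sup>2) < (cmod c)\<^sup>2 * (5 * (cmod (v $ i))\<^sup>2)"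
    using u(2) by (simp add: c norm_mult power_mult_distrib algebra_simps)
  then show "(cmod (v $ (i + 1)))\<^sup>2 + (cmod (v $ (i + 2)))\<^sup>2 < 5 * (cmod (v $ i))\<^sup>2"
    using \<open>c \<noteq> 0\<close> by simp
qed (auto simp: sector_def)

lemma sector_subset: "sector i \<subseteq> CP2_affine_domain i"
  unfolding sector_def by (auto dest: sector_nonzero)

lemma openin_sector: "openin CP2_topology (sector i)"
proof -
  have "v \<noteq> 0 \<and> vec.span {v} \<in> sector i \<longleftrightarrow>
      (cmod (v $ (i + 1)))\<^sup>2 + (cmod (v $ (i + 2)))\<^sup>2 < 5 * (cmod (v $ i))\<^sup>2" for v
    by (cases "v = 0") (simp_all add: span_mem_sector)
  then have "{v. v \<noteq> 0 \<and> vec.span {v} \<in> sector i} =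
      {v. (cmod (v $ (i + 1)))\<^sup>2 + (cmod (v $ (i + 2)))\<^sup>2 < 5 * (cmod (v $ i))\<^sup>2}"
    by simp
  moreover have "open \<dots>"
    by (intro open_Collect_less continuous_intros)
  moreover have "sector i \<subseteq> CP2_points"
    using sector_subset[of i] by (auto simp: CP2_affine_domain_def)
  ultimately show ?thesis
    by (simp add: openin_CP2_topology)
qed

lemma sector_cover: "(\<Union>i. sector i) = CP2_points"
proof
  show "(\<Union>i. sector i) \<subseteq> CP2_points"
    using sector_subset by (fastforce simp: CP2_affine_domain_def)
  show "CP2_points \<subseteq> (\<Union>i. sector i)"
  proof
    fix L assume "L \<in> CP2_points"
    then obtain v where v: "v \<noteq> 0" "L = vec.span {v}" by (rule CP2_pointsE)
    define n where "n i = (cmod (v $ i))\<^sup>2" for i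
    have "Max (range n) \<in> range n" by (rule Max_in) auto
    then obtain i where "n i = Max (range n)" by (metis imageE)
    then have i: "n j \<le> n i" for j by simp
    have "n i > 0"
    proof (rule ccontr)
      assume "\<not> n i > 0"
      then have "n j \<le> 0" for j using i[of j] by linarith
      then have "v = 0" by (simp add: n_def vec_eq_iff)
      with v(1) show False by simp
    qed
    \<comment> \<open>The other two squared moduli add up to at most \<open>2 * n i\<close>, which
      is below \<open>5 * n i\<close> as \<open>n i\<close> is positive.\<close>
    then have "vec.span {v} \<in> sector i"
      using i[of "i + 1"] i[of "i + 2"] unfolding span_mem_sector[OF v(1)] n_def by linarith
    then show "L \<in> (\<Union>i. sector i)" using v(2) by blast
  qed
qed

section \<open>The sectors in an affine chart\<close>

lemma homog_mem_sector:
  "vec.span {homog i w} \<in> sector i \<longleftrightarrow> (cmod (w $ 1))\<^sup>2 + (cmod (w $ 2))\<^sup>2 < 5"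
  "vec.span {homog i w} \<in> sector (i + 1) \<longleftrightarrow> 1 + (cmod (w $ 2))\<^sup>2 < 5 * (cmod (w $ 1))\<^sup>2"
  "vec.span {homog i w} \<in> sector (i + 2) \<longleftrightarrow> 1 + (cmod (w $ 1))\<^sup>2 < 5 * (cmod (w $ 2))\<^sup>2"
  by (simp_all only: span_mem_sector[OF homog_nonzero] index_3 homog_nth) auto

lemma norm_vec_2: "(norm (w :: complex^2))\<^sup>2 = (cmod (w $ 1))\<^sup>2 + (cmod (w $ 2))\<^sup>2"
  by (simp add: norm_vec_def L2_set_def sum_2)

lemma coords_sector: "CP2_affine_coords i ` sector i = ball 0 (sqrt 5)"
proof -
  have "norm (w :: complex^2) < sqrt 5 \<longleftrightarrow> (cmod (w $ 1))\<^sup>2 + (cmod (w $ 2))\<^sup>2 < 5" for w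
    unfolding norm_vec_2[symmetric] by (metis abs_norm_cancel real_sqrt_abs real_sqrt_less_iff)
  then show ?thesis
    unfolding affine_coords_image[OF sector_subset] homog_mem_sector(1) by (simp add: ball_def)
qed

lemma Stein_sector: "Stein (open_submanifold CP2 (sector i))"
  using global_chart.Stein_ball[OF global_chart_CP2(1)[OF openin_sector sector_subset]]
    coords_sector unfolding global_chart_CP2(2)[OF openin_sector sector_subset] by blast

lemma diffeomorphic_sector: "diffeomorphic_to (open_submanifold CP2 (sector i)) (handlebody 0)"
proof (rule diffeomorphic_to_CP2I[OF openin_sector sector_subset])
  let ?F = "\<lambda>w :: complex^2. ((1 / sqrt 5) *\<^sub>R w $ 1, (1 / sqrt 5) *\<^sub>R w $ 2)"
  let ?G = "\<lambda>z. vector [sqrt 5 *\<^sub>R fst z, sqrt 5 *\<^sub>R snd z] :: complex^2"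
  show "Cinf_on ?F (CP2_affine_coords i ` sector i)" "Cinf_on ?G UNIV"
    unfolding coords_sector by (intro Cinf_on_intros open_ball open_UNIV)+
  have im: "CP2_affine_coords i ` sector i = {w. (cmod (w $ 1))\<^sup>2 + (cmod (w $ 2))\<^sup>2 < 5}"
    by (simp add: affine_coords_image[OF sector_subset] homog_mem_sector)
  show "?F w \<in> handlebody 0 \<and> ?G (?F w) = w" if "w \<in> CP2_affine_coords i ` sector i" for w
    using that unfolding im
    by (simp add: handlebody_def planar_fun_def power_divide power_mult_distrib vec_eq_iff forall_2 field_simps)
  show "?G z \<in> CP2_affine_coords i ` sector i \<and> ?F (?G z) = z" if "z \<in> handlebody 0" for z
    using that unfolding im
    by (auto simp: handlebody_def planar_fun_def power_mult_distrib)
qed simp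

subsection \<open>The pairwise intersections\<close>

text \<open>For fixed \<open>y\<close> the squared radius \<open>X = \<bar>x\<bar>\<^sup>2\<close> ranges over an interval of length
  proportional to \<open>4 - \<bar>y\<bar>\<^sup>2\<close>, while on the handlebody \<open>\<bar>p\<bar>\<^sup>2 - 17/2\<close> ranges over one whose length is
  proportional to \<open>sqrt (4 - \<bar>y\<bar>\<^sup>2)\<close>; \<open>radial X Y\<close> is the affine bijection between the two.\<close>

definition radial :: "real \<Rightarrow> real \<Rightarrow> real" where
  "radial X Y = 5/4 * (5 * X - 13 + 2 * Y) / sqrt (4 - Y)"

definition radial_inv :: "real \<Rightarrow> real \<Rightarrow> real" where
  "radial_inv t Y = (13 - 2 * Y + 4/5 * t * sqrt (4 - Y)) / 5"

lemma power2_less_power2_iff: "0 \<le> b \<Longrightarrow> a\<^sup>2 < b\<^sup>2 \<longleftrightarrow> - b < a \<and> a < b" for a b :: real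
  using abs_le_square_iff[of b a] by auto

text \<open>The bound on the square is the condition defining \<open>handlebody 1\<close> when
  \<open>w\<close> is 15/4 times \<open>y\<close>, since 225/16 is the square of 15/4. The
  positivity statements justify the later roots and quotients.\<close>

lemma radial_bounds:
  assumes "X + Y < 5" "1 + Y < 5 * X" "0 \<le> Y"
  shows "Y < 4" "(radial X Y)\<^sup>2 < 225/4 - 225/16 * Y" "17/2 + radial X Y > 0" "X > 0"
    "radial_inv (radial X Y) Y = X"
proof -
  show Y: "Y < 4" "X > 0" using assms by linarith+
  \<comment> \<open>For fixed \<open>Y\<close> the variable \<open>X\<close> lies between
    \<open>(1 + Y) / 5\<close> and \<open>5 - Y\<close>, with midpoint
    \<open>(13 - 2 * Y) / 5\<close> and half-length \<open>3 * (4 - Y) / 5\<close>;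
    \<open>?m\<close> is five times the deviation from the midpoint.\<close>
  let ?m = "5 * X - 13 + 2 * Y"
  have m: "?m\<^sup>2 < (3 * (4 - Y))\<^sup>2"
    using assms Y by (subst power2_less_power2_iff) auto
  have "(radial X Y)\<^sup>2 = 25/16 * ?m\<^sup>2 / (4 - Y)"
    unfolding radial_def power_divide power_mult_distrib using Y by (simp add: power2_eq_square)
  also have "\<dots> < 25/16 * (3 * (4 - Y))\<^sup>2 / (4 - Y)"
    using m Y by (intro divide_strict_right_mono) auto
  also have "\<dots> = 225/4 - 225/16 * Y"
    using Y by (simp add: power2_eq_square field_simps)
  finally show r: "(radial X Y)\<^sup>2 < 225/4 - 225/16 * Y" .
  then have "(radial X Y)\<^sup>2 < (15/2)\<^sup>2" using assms(3) by (simp add: power2_eq_square)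
  then have "- (15/2) < radial X Y" by (subst (asm) power2_less_power2_iff) auto
  then show "17/2 + radial X Y > 0" by linarith
  show "radial_inv (radial X Y) Y = X"
    using Y by (simp add: radial_def radial_inv_def field_simps)
qed

text \<open>Here \<open>Y < 4\<close> is forced by a square being nonnegative; then the bound on
  \<open>t\<close> bounds the deviation of \<open>X\<close> from its midpoint.\<close>

lemma radial_inv_bounds:
  assumes "t\<^sup>2 < 225/4 - 225/16 * Y" "0 \<le> Y"
  shows "Y < 4" "radial_inv t Y + Y < 5" "1 + Y < 5 * radial_inv t Y" "17/2 + t > 0"
    "radial (radial_inv t Y) Y = t"
proof -
  show Y: "Y < 4" using assms(1) zero_le_power2[of t] by linarith
  define m where "m = 4/5 * t * sqrt (4 - Y)"
  have X: "radial_inv t Y = (13 - 2 * Y + m) / 5"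
    by (simp add: radial_inv_def m_def)
  have "m\<^sup>2 = 16/25 * t\<^sup>2 * (4 - Y)"
    using Y by (simp add: m_def power_mult_distrib power_divide)
  also have "\<dots> < 16/25 * (225/4 - 225/16 * Y) * (4 - Y)"
    using assms(1) Y by (intro mult_strict_right_mono) auto
  also have "\<dots> = (3 * (4 - Y))\<^sup>2"
    by (simp add: power2_eq_square field_simps)
  finally have m: "- (3 * (4 - Y)) < m" "m < 3 * (4 - Y)"
    using Y by (subst (asm) power2_less_power2_iff; simp)+
  then show "radial_inv t Y + Y < 5" "1 + Y < 5 * radial_inv t Y"
    by (simp_all add: X field_simps)
  have "t\<^sup>2 < (15/2)\<^sup>2" using assms by (simp add: power2_eq_square)
  then have "- (15/2) < t" by (subst (asm) power2_less_power2_iff) auto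
  then show "17/2 + t > 0" by linarith
  have "5 * radial_inv t Y - 13 + 2 * Y = m" by (simp add: X field_simps)
  then show "radial (radial_inv t Y) Y = t"
    unfolding radial_def using Y by (simp add: m_def)
qed

lemma Cinf_on_radial:
  assumes "Cinf_on f S" "Cinf_on g S" "\<And>x. x \<in> S \<Longrightarrow> g x < 4"
  shows "Cinf_on (\<lambda>x. radial (f x) (g x)) S" "Cinf_on (\<lambda>x. radial_inv (f x) (g x)) S"
proof -
  note [intro!] = Cinf_on_open[OF assms(1)]
  have "Cinf_on (\<lambda>x. sqrt (4 - g x)) S"
    using assms(3) by (intro Cinf_on_intros assms) auto
  moreover have "sqrt (4 - g x) \<noteq> 0" if "x \<in> S" for x
    using assms(3)[OF that] by simp
  ultimately show "Cinf_on (\<lambda>x. radial (f x) (g x)) S" "Cinf_on (\<lambda>x. radial_inv (f x) (g x)) S"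
    unfolding radial_def radial_inv_def
    by (intro Cinf_on_add Cinf_on_diff Cinf_on_mult Cinf_on_divide Cinf_on_const assms; auto)+
qed

lemma handlebody_1_iff:
  "z \<in> handlebody 1 \<longleftrightarrow> ((cmod (fst z))\<^sup>2 - 17/2)\<^sup>2 < 225/4 - (cmod (snd z))\<^sup>2"
  by (cases z) (auto simp: handlebody_def planar_fun_1[unfolded One_nat_def] power_divide)

text \<open>The first coordinate keeps its argument and gets squared modulus
  \<open>17/2 + radial X Y\<close>; the second is only scaled, which is smooth through its zero. The
  factor 15/4 takes the bound 2 on its modulus to 15/2, the bound in the model.\<close>

definition pair_map :: "complex^2 \<Rightarrow> complex \<times> complex" where
  "pair_map w =
     (sqrt ((17/2 + radial ((cmod (w $ 1))\<^sup>2) ((cmod (w $ 2))\<^sup>2)) / (cmod (w $ 1))\<^sup>2) *\<^sub>R w $ 1,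
      (15/4) *\<^sub>R w $ 2)"

definition pair_inv :: "complex \<times> complex \<Rightarrow> complex^2" where
  "pair_inv z = vector
     [sqrt (radial_inv ((cmod (fst z))\<^sup>2 - 17/2) (16/225 * (cmod (snd z))\<^sup>2) / (cmod (fst z))\<^sup>2) *\<^sub>R fst z,
      (4/15) *\<^sub>R snd z]"

lemma coords_pair:
  "CP2_affine_coords i ` (sector i \<inter> sector (i + 1)) =
     {w. (cmod (w $ 1))\<^sup>2 + (cmod (w $ 2))\<^sup>2 < 5 \<and> 1 + (cmod (w $ 2))\<^sup>2 < 5 * (cmod (w $ 1))\<^sup>2}"
  using sector_subset[of i] by (subst affine_coords_image) (auto simp: homog_mem_sector)

lemma diffeomorphic_pair:
  "diffeomorphic_to (open_submanifold CP2 (sector i \<inter> sector (i + 1))) (handlebody 1)"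
proof (rule diffeomorphic_to_CP2I)
  show Z: "openin CP2_topology (sector i \<inter> sector (i + 1))"
    "sector i \<inter> sector (i + 1) \<subseteq> CP2_affine_domain i"
    using openin_sector sector_subset by blast+
  have "open (CP2_affine_coords i ` (sector i \<inter> sector (i + 1)))"
    by (rule is_chart_open_image[OF is_chart_CP2 Z])
  then show "Cinf_on pair_map (CP2_affine_coords i ` (sector i \<inter> sector (i + 1)))"
    unfolding pair_map_def
    by (intro Cinf_on_intros Cinf_on_radial divide_pos_pos)
      (auto simp: coords_pair dest: radial_bounds)
  have "handlebody 1 = {z. ((cmod (fst z))\<^sup>2 - 17/2)\<^sup>2 < 225/4 - (cmod (snd z))\<^sup>2}"
    using handlebody_1_iff by blast
  then have op: "open (handlebody 1)"
    by (simp only:) (intro open_Collect_less continuous_intros)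
  \<comment> \<open>The factors cancel: this is the handlebody condition in the shape required by
    \<open>radial_inv_bounds\<close>, with \<open>Y\<close> the squared modulus of
    \<open>(4/15) *\<^sub>R snd z\<close>.\<close>
  have z: "((cmod (fst z))\<^sup>2 - 17/2)\<^sup>2 < 225/4 - 225/16 * (16/225 * (cmod (snd z))\<^sup>2)"
    if "z \<in> handlebody 1" for z using that unfolding handlebody_1_iff by simp
  note rb = radial_inv_bounds[OF z]
  have pos: "(cmod (fst z))\<^sup>2 > 0" "radial_inv ((cmod (fst z))\<^sup>2 - 17/2) (16/225 * (cmod (snd z))\<^sup>2) > 0"
    if "z \<in> handlebody 1" for z
    using rb(3,4)[OF that] zero_le_power2[of "cmod (snd z)"] by (simp, linarith)
  show "Cinf_on pair_inv (handlebody 1)"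
    unfolding pair_inv_def
    using op by (intro Cinf_on_intros Cinf_on_radial divide_pos_pos)
      (auto dest: pos rb(1) simp del: One_nat_def)
  show "pair_map w \<in> handlebody 1 \<and> pair_inv (pair_map w) = w"
    if "w \<in> CP2_affine_coords i ` (sector i \<inter> sector (i + 1))" for w
  proof -
    let ?X = "(cmod (w $ 1))\<^sup>2" and ?Y = "(cmod (w $ 2))\<^sup>2"
    have w: "?X + ?Y < 5" "1 + ?Y < 5 * ?X" using that by (auto simp: coords_pair)
    note b = radial_bounds[OF w zero_le_power2]
    have 1: "(cmod (fst (pair_map w)))\<^sup>2 = 17/2 + radial ?X ?Y"
      using b(3,4) by (simp add: pair_map_def power_mult_distrib)
    have 2: "(cmod (snd (pair_map w)))\<^sup>2 = 225/16 * ?Y"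
      by (simp add: pair_map_def power_mult_distrib power_divide)
    \<comment> \<open>The inverse rescales by the reciprocal factor, because it sees
      \<open>17/2 + radial ?X ?Y\<close> as squared modulus and recovers \<open>?X\<close> from
      it.\<close>
    have "sqrt (?X / (17/2 + radial ?X ?Y)) * sqrt ((17/2 + radial ?X ?Y) / ?X) = 1"
      using b(3,4) by (simp flip: real_sqrt_mult)
    then have "sqrt (?X / (17/2 + radial ?X ?Y)) *\<^sub>R fst (pair_map w) = w $ 1"
      by (simp add: pair_map_def)
    moreover have "(4/15) *\<^sub>R snd (pair_map w) = w $ 2"
      by (simp add: pair_map_def)
    ultimately have "pair_inv (pair_map w) = w"
      using b(5) by (simp add: pair_inv_def 1 2 vec_eq_iff forall_2)
    then show ?thesis
      using b(2) unfolding handlebody_1_iff 1 2 by simp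
  qed
  show "pair_inv z \<in> CP2_affine_coords i ` (sector i \<inter> sector (i + 1)) \<and> pair_map (pair_inv z) = z"
    if "z \<in> handlebody 1" for z
  proof -
    let ?P = "(cmod (fst z))\<^sup>2" and ?Y = "16/225 * (cmod (snd z))\<^sup>2"
    let ?X = "radial_inv (?P - 17/2) ?Y"
    note p = pos[OF that] and b = rb[OF that]
    have 1: "(cmod (pair_inv z $ 1))\<^sup>2 = ?X"
      using p by (simp add: pair_inv_def power_mult_distrib)
    have 2: "(cmod (pair_inv z $ 2))\<^sup>2 = ?Y"
      by (simp add: pair_inv_def power_mult_distrib power_divide)
    have "sqrt (?P / ?X) * sqrt (?X / ?P) = 1"
      using p by (simp flip: real_sqrt_mult)
    then have "sqrt (?P / ?X) *\<^sub>R pair_inv z $ 1 = fst z"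
      by (simp add: pair_inv_def)
    moreover have "(15/4) *\<^sub>R pair_inv z $ 2 = snd z"
      by (simp add: pair_inv_def)
    ultimately have "pair_map (pair_inv z) = z"
      using b(5) unfolding pair_map_def 1 2 by (simp add: prod_eq_iff)
    then show ?thesis
      using b(2,3) unfolding coords_pair by (simp add: 1 2)
  qed
qed simp

subsection \<open>The triple intersection\<close>

text \<open>In the squared moduli \<open>X\<close>, \<open>Y\<close> of the affine coordinates the triple intersection is an open
  triangle. The ratios of the three defining affine forms identify it with the open quadrant,
  logarithms with the plane, and \<open>squash\<close> with the open disk.\<close>

definition squash :: "complex \<Rightarrow> complex" where
  "squash v = (1 / sqrt (1 + (cmod v)\<^sup>2)) *\<^sub>R v"

definition unsquash :: "complex \<Rightarrow> complex" where
  "unsquash d = (1 / sqrt (1 - (cmod d)\<^sup>2)) *\<^sub>R d"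

lemma one_plus_power2_pos: "1 + x\<^sup>2 > 0" for x :: real
  using zero_le_power2[of x] by linarith

lemma norm_squash: "(cmod (squash v))\<^sup>2 = (cmod v)\<^sup>2 / (1 + (cmod v)\<^sup>2)"
  using one_plus_power2_pos[of "cmod v"] by (simp add: squash_def power_mult_distrib power_divide)

lemma squash_in_ball: "squash v \<in> ball 0 1"
proof -
  have "(cmod (squash v))\<^sup>2 < 1\<^sup>2"
    unfolding norm_squash using one_plus_power2_pos[of "cmod v"] by simp
  then show ?thesis by (subst (asm) power2_less_power2_iff) auto
qed

lemma unsquash_squash: "unsquash (squash v) = v"
proof -
  have "1 - (cmod (squash v))\<^sup>2 = 1 / (1 + (cmod v)\<^sup>2)"
    unfolding norm_squash using one_plus_power2_pos[of "cmod v"] by (simp add: field_simps)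
  then have "unsquash (squash v) = (sqrt (1 + (cmod v)\<^sup>2) * (1 / sqrt (1 + (cmod v)\<^sup>2))) *\<^sub>R v"
    by (simp add: unsquash_def squash_def real_sqrt_divide)
  then show ?thesis
    using one_plus_power2_pos[of "cmod v"] by simp
qed

lemma ball_power2: "d \<in> ball 0 1 \<Longrightarrow> 1 - (cmod d)\<^sup>2 > 0"
  using power2_less_power2_iff[of 1 "cmod d"] norm_ge_zero[of d] by (simp del: norm_ge_zero)

lemma squash_unsquash:
  assumes "d \<in> ball 0 1"
  shows "squash (unsquash d) = d"
proof -
  note d = ball_power2[OF assms]
  have "1 + (cmod (unsquash d))\<^sup>2 = 1 / (1 - (cmod d)\<^sup>2)"
    using d by (simp add: unsquash_def power_mult_distrib power_divide field_simps)
  then have "squash (unsquash d) = (sqrt (1 - (cmod d)\<^sup>2) * (1 / sqrt (1 - (cmod d)\<^sup>2))) *\<^sub>R d"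
    by (simp add: unsquash_def squash_def real_sqrt_divide)
  then show ?thesis using d by simp
qed

lemma Cinf_on_squash: "Cinf_on f S \<Longrightarrow> Cinf_on (\<lambda>x. squash (f x)) S"
  unfolding squash_def
  by (intro Cinf_on_scaleR Cinf_on_divide Cinf_on_sqrt Cinf_on_add Cinf_on_const
      Cinf_on_cmod_power2 one_plus_power2_pos)
    (auto dest: Cinf_on_open simp: less_imp_neq[OF one_plus_power2_pos, symmetric])

lemma Cinf_on_unsquash:
  assumes "Cinf_on f S" "\<And>x. x \<in> S \<Longrightarrow> f x \<in> ball 0 1"
  shows "Cinf_on (\<lambda>x. unsquash (f x)) S"
proof -
  have "1 - (cmod (f x))\<^sup>2 > 0" if "x \<in> S" for x
    using ball_power2[OF assms(2)[OF that]] .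
  moreover from this have "sqrt (1 - (cmod (f x))\<^sup>2) \<noteq> 0" if "x \<in> S" for x
    using that by fastforce
  ultimately show ?thesis
    unfolding unsquash_def using assms(1) Cinf_on_open[OF assms(1)]
    by (intro Cinf_on_scaleR Cinf_on_divide Cinf_on_sqrt Cinf_on_diff Cinf_on_const
        Cinf_on_cmod_power2)
qed

definition triangle :: "real \<Rightarrow> real \<Rightarrow> bool" where
  "triangle X Y \<longleftrightarrow> X + Y < 5 \<and> 1 + Y < 5 * X \<and> 1 + X < 5 * Y"

definition triangle_map :: "real \<Rightarrow> real \<Rightarrow> complex" where
  "triangle_map X Y = squash (Complex (ln ((5 * X - 1 - Y) / (5 - X - Y))) (ln ((5 * Y - 1 - X) / (5 - X - Y))))"

text \<open>For \<open>a = 5 - X - Y\<close>, \<open>b = 5 * X - 1 - Y\<close>,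
  \<open>c = 5 * Y - 1 - X\<close> one has \<open>4 * a + b + c = 18\<close>,
  \<open>18 * X = 4 * b + a + c\<close> and \<open>18 * Y = 4 * c + a + b\<close>. Dividing by
  \<open>a\<close> leaves only the ratios \<open>b / a\<close> and \<open>c / a\<close>, which are
  the exponentials here.\<close>

definition triangle_inv_X :: "complex \<Rightarrow> real" where
  "triangle_inv_X d = (4 * exp (Re (unsquash d)) + 1 + exp (Im (unsquash d))) /
     (4 + exp (Re (unsquash d)) + exp (Im (unsquash d)))"

definition triangle_inv_Y :: "complex \<Rightarrow> real" where
  "triangle_inv_Y d = (4 * exp (Im (unsquash d)) + 1 + exp (Re (unsquash d))) /
     (4 + exp (Re (unsquash d)) + exp (Im (unsquash d)))"

lemma triangle_map_in_ball: "triangle_map X Y \<in> ball 0 1"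
  by (simp only: triangle_map_def squash_in_ball)

lemma triangle_inv_map:
  assumes "triangle X Y"
  shows "triangle_inv_X (triangle_map X Y) = X" "triangle_inv_Y (triangle_map X Y) = Y"
proof -
  have pos: "5 - X - Y > 0" "5 * X - 1 - Y > 0" "5 * Y - 1 - X > 0"
    using assms by (auto simp: triangle_def)
  have frac: "(4 * (b / a) + 1 + c / a) / (4 + b / a + c / a) = (4 * b + a + c) / (4 * a + b + c)"
    if "a > 0" for a b c :: real
  proof -
    have "4 * (b / a) + 1 + c / a = (4 * b + a + c) / a" "4 + b / a + c / a = (4 * a + b + c) / a"
      using that by (simp_all add: field_simps)
    then show ?thesis using that by simp
  qed
  show "triangle_inv_X (triangle_map X Y) = X" "triangle_inv_Y (triangle_map X Y) = Y"
    using frac[OF pos(1), of "5 * X - 1 - Y" "5 * Y - 1 - X"]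
      frac[OF pos(1), of "5 * Y - 1 - X" "5 * X - 1 - Y"] pos
    by (simp_all add: triangle_inv_X_def triangle_inv_Y_def triangle_map_def unsquash_squash algebra_simps)
qed

lemma triangle_inv:
  assumes "d \<in> ball 0 1"
  shows "triangle (triangle_inv_X d) (triangle_inv_Y d)"
    and "triangle_map (triangle_inv_X d) (triangle_inv_Y d) = d"
    and "triangle_inv_X d > 0" "triangle_inv_Y d > 0"
proof -
  define b e where "b = exp (Re (unsquash d))" and "e = exp (Im (unsquash d))"
  have pos: "b > 0" "e > 0" by (simp_all add: b_def e_def)
  let ?X = "triangle_inv_X d" and ?Y = "triangle_inv_Y d"
  have X: "?X = (4 * b + 1 + e) / (4 + b + e)" and Y: "?Y = (4 * e + 1 + b) / (4 + b + e)"
    by (simp_all add: triangle_inv_X_def triangle_inv_Y_def b_def e_def)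
  define N where "N = 4 + b + e"
  have N: "N > 0" "N \<noteq> 0" using pos by (auto simp: N_def)
  have "?X * N = 4 * b + 1 + e" "?Y * N = 4 * e + 1 + b"
    using N(2) unfolding X Y N_def[symmetric] by simp_all
  \<comment> \<open>The three forms are 1, \<open>b\<close> and \<open>e\<close> up to the common
    factor \<open>18 / N\<close>; their sum with weights 4, 1, 1 is constantly 18.\<close>
  then have "(5 - ?X - ?Y) * N = 18" "(5 * ?X - 1 - ?Y) * N = 18 * b" "(5 * ?Y - 1 - ?X) * N = 18 * e"
    unfolding left_diff_distrib mult.assoc by (simp_all add: N_def)
  then have forms: "5 - ?X - ?Y = 18 / N" "5 * ?X - 1 - ?Y = 18 * b / N" "5 * ?Y - 1 - ?X = 18 * e / N"
    by (simp_all only: nonzero_eq_divide_eq[OF N(2)])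
  have gt: "5 - ?X - ?Y > 0" "5 * ?X - 1 - ?Y > 0" "5 * ?Y - 1 - ?X > 0"
    unfolding forms using pos N(1) by simp_all
  then show "triangle ?X ?Y" by (simp add: triangle_def)
  show "?X > 0" "?Y > 0"
    unfolding X Y using pos by (simp_all add: add_pos_pos)
  have "triangle_map ?X ?Y = squash (Complex (ln b) (ln e))"
    unfolding triangle_map_def forms using N(2) by simp
  also have "\<dots> = d"
    using squash_unsquash[OF assms] by (simp add: b_def e_def)
  finally show "triangle_map ?X ?Y = d" .
qed

lemma Cinf_on_triangle_map:
  assumes "Cinf_on f S" "Cinf_on g S" "\<And>x. x \<in> S \<Longrightarrow> triangle (f x) (g x)"
  shows "Cinf_on (\<lambda>x. triangle_map (f x) (g x)) S"
proof -
  have pos: "5 - f x - g x > 0" "5 * f x - 1 - g x > 0" "5 * g x - 1 - f x > 0" if "x \<in> S" for x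
    using assms(3)[OF that] by (auto simp: triangle_def)
  have nz: "5 - f x - g x \<noteq> 0" if "x \<in> S" for x
    using pos(1)[OF that] by linarith
  show ?thesis
    unfolding triangle_map_def
    by (intro Cinf_on_squash Cinf_on_Complex Cinf_on_ln Cinf_on_divide Cinf_on_diff Cinf_on_mult
        Cinf_on_const assms(1,2) Cinf_on_open[OF assms(1)] divide_pos_pos pos nz)
qed

lemma Cinf_on_triangle_inv:
  assumes "Cinf_on f S" "\<And>x. x \<in> S \<Longrightarrow> f x \<in> ball 0 1"
  shows "Cinf_on (\<lambda>x. triangle_inv_X (f x)) S" "Cinf_on (\<lambda>x. triangle_inv_Y (f x)) S"
proof -
  have nz: "4 + exp a + exp b \<noteq> 0" for a b :: real
    using exp_gt_zero[of a] exp_gt_zero[of b] by linarith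
  note u = Cinf_on_unsquash[OF assms]
  show "Cinf_on (\<lambda>x. triangle_inv_X (f x)) S" "Cinf_on (\<lambda>x. triangle_inv_Y (f x)) S"
    unfolding triangle_inv_X_def triangle_inv_Y_def
    using Cinf_on_open[OF assms(1)]
    by (auto intro!: Cinf_on_divide Cinf_on_add Cinf_on_mult Cinf_on_const Cinf_on_exp Cinf_on_Re
        Cinf_on_Im u simp: nz)
qed

section \<open>The torus times a disk\<close>

lemma genus_surface_1_iff:
  "z \<in> genus_surface 1 \<longleftrightarrow> ((cmod (fst z))\<^sup>2 - 17/2)\<^sup>2 + (snd z)\<^sup>2 = 225/4"
  by (cases z) (auto simp: genus_surface_def planar_fun_1[unfolded One_nat_def] power_divide)

text \<open>On \<open>genus_surface 1\<close> the pair of \<open>(cmod p)^2 - 17/2\<close> and the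
  height runs over a circle of radius 15/2. The direction of the second coordinate picks the point
  on it, the direction of the first is the angle of \<open>p\<close>, and the moduli go to the
  disk.\<close>

definition torus_map :: "complex^2 \<Rightarrow> (complex \<times> real) \<times> complex" where
  "torus_map w =
     (((sqrt (17/2 + 15/2 * (Re (w $ 2) / cmod (w $ 2))) / cmod (w $ 1)) *\<^sub>R w $ 1,
       15/2 * (Im (w $ 2) / cmod (w $ 2))),
      triangle_map ((cmod (w $ 1))\<^sup>2) ((cmod (w $ 2))\<^sup>2))"

text \<open>On the surface the \<open>Complex\<close> number has modulus 15/2, so the factor 2/15
  turns it into a unit direction.\<close>

definition torus_inv :: "(complex \<times> real) \<times> complex \<Rightarrow> complex^2" where
  "torus_inv z = vector
     [(sqrt (triangle_inv_X (snd z)) / cmod (fst (fst z))) *\<^sub>R fst (fst z),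
      (2/15 * sqrt (triangle_inv_Y (snd z))) *\<^sub>R
        Complex ((cmod (fst (fst z)))\<^sup>2 - 17/2) (snd (fst z))]"

lemma Int_sector: "(\<Inter>i. sector i) = sector i \<inter> sector (i + 1) \<inter> sector (i + 2)"
  unfolding UNIV_3_cyclic[of i] by auto

lemma coords_triple:
  "CP2_affine_coords i ` (\<Inter>i. sector i) = {w. triangle ((cmod (w $ 1))\<^sup>2) ((cmod (w $ 2))\<^sup>2)}"
  using sector_subset[of i] unfolding Int_sector[of i]
  by (subst affine_coords_image) (auto simp: homog_mem_sector triangle_def)

lemma diffeomorphic_triple:
  "diffeomorphic_to (open_submanifold CP2 (\<Inter>i. sector i)) (genus_surface 1 \<times> ball (0::complex) 1)"
proof (rule diffeomorphic_to_CP2I)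
  \<comment> \<open>The three sectors enter symmetrically; one affine chart is fixed.\<close>
  define i :: 3 where "i = 1"
  let ?O = "CP2_affine_coords i ` (\<Inter>i. sector i)"
  show Z: "openin CP2_topology (\<Inter>i. sector i)" "(\<Inter>i. sector i) \<subseteq> CP2_affine_domain i"
    using openin_sector sector_subset[of i] unfolding Int_sector[of i] by (blast intro: openin_Int)+
  have op: "open ?O"
    by (rule is_chart_open_image[OF is_chart_CP2 Z])
  have O: "triangle ((cmod (w $ 1))\<^sup>2) ((cmod (w $ 2))\<^sup>2)" "w $ 1 \<noteq> 0" "w $ 2 \<noteq> 0"
    "cmod (w $ 1) \<noteq> 0" "cmod (w $ 2) \<noteq> 0" "17/2 + 15/2 * (Re (w $ 2) / cmod (w $ 2)) > 0" if "w \<in> ?O" for w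
  proof -
    show t: "triangle ((cmod (w $ 1))\<^sup>2) ((cmod (w $ 2))\<^sup>2)"
      using that by (simp add: coords_triple)
    show nz: "w $ 1 \<noteq> 0" "w $ 2 \<noteq> 0"
    proof -
      have "(cmod (w $ 1))\<^sup>2 > 0" "(cmod (w $ 2))\<^sup>2 > 0"
        using t zero_le_power2[of "cmod (w $ 1)"] zero_le_power2[of "cmod (w $ 2)"]
        unfolding triangle_def by linarith+
      then show "w $ 1 \<noteq> 0" "w $ 2 \<noteq> 0" by auto
    qed
    then show "cmod (w $ 1) \<noteq> 0" "cmod (w $ 2) \<noteq> 0" by simp_all
    \<comment> \<open>The quotient is a cosine, so the radicand is at least 17/2 - 15/2 = 1.\<close>
    have "\<bar>Re (w $ 2) / cmod (w $ 2)\<bar> \<le> 1"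
      using nz abs_Re_le_cmod[of "w $ 2"] by simp
    then show "17/2 + 15/2 * (Re (w $ 2) / cmod (w $ 2)) > 0" by linarith
  qed
  show "Cinf_on torus_map ?O"
    unfolding torus_map_def
    by (intro Cinf_on_Pair Cinf_on_triangle_map Cinf_on_scaleR Cinf_on_cmod_power2 Cinf_on_divide
        Cinf_on_sqrt Cinf_on_add Cinf_on_mult Cinf_on_const Cinf_on_Re Cinf_on_Im Cinf_on_cmod
        Cinf_on_vec_nth op O)
  \<comment> \<open>The surface is not open, so the inverse needs a smooth extension; its formula
    asks only for \<open>p \<noteq> 0\<close> and a point of the disk.\<close>
  let ?W = "{z :: (complex \<times> real) \<times> complex. fst (fst z) \<noteq> 0} \<inter> {z. cmod (snd z) < 1}"
  have opW: "open ?W"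
    by (intro open_Int open_Collect_neq open_Collect_less continuous_intros)
  have W: "fst (fst z) \<noteq> 0" "cmod (fst (fst z)) \<noteq> 0" "snd z \<in> ball 0 1" if "z \<in> ?W" for z
    using that by auto
  show "Cinf_on torus_inv ?W"
    unfolding torus_inv_def
    by (intro Cinf_on_vector_2 Cinf_on_scaleR Cinf_on_cmod_power2 Cinf_on_divide Cinf_on_triangle_inv
        Cinf_on_sqrt Cinf_on_diff Cinf_on_mult Cinf_on_const Cinf_on_Complex Cinf_on_cmod
        Cinf_on_fst Cinf_on_snd Cinf_on_ident opW W triangle_inv(3,4))
  show sub: "genus_surface 1 \<times> ball 0 1 \<subseteq> ?W"
  proof
    fix z :: "(complex \<times> real) \<times> complex" assume z: "z \<in> genus_surface 1 \<times> ball 0 1"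
    then have *: "((cmod (fst (fst z)))\<^sup>2 - 17/2)\<^sup>2 + (snd (fst z))\<^sup>2 = 225/4"
      using genus_surface_1_iff[of "fst z"] by auto
    \<comment> \<open>At \<open>p = 0\<close> the first square alone is 289/4, which exceeds
      225/4.\<close>
    have "fst (fst z) \<noteq> 0"
    proof
      assume "fst (fst z) = 0"
      with * show False using zero_le_power2[of "snd (fst z)"] by (simp add: power_divide)
    qed
    then show "z \<in> ?W" using z by auto
  qed
  show "torus_map w \<in> genus_surface 1 \<times> ball 0 1 \<and> torus_inv (torus_map w) = w" if w: "w \<in> ?O" for w
  proof -
    note o = O[OF w]
    define c where "c = Re (w $ 2) / cmod (w $ 2)"
    define s where "s = Im (w $ 2) / cmod (w $ 2)"
    have cs: "c\<^sup>2 + s\<^sup>2 = 1"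
      using o(5) unfolding c_def s_def power_divide add_divide_distrib[symmetric] cmod_power2[symmetric]
      by simp
    have c: "17/2 + 15/2 * c > 0" using o(6) by (simp add: c_def)
    have p: "cmod (fst (fst (torus_map w))) = sqrt (17/2 + 15/2 * c)"
      using o(4) c by (simp add: torus_map_def flip: c_def)
    have z: "snd (fst (torus_map w)) = 15/2 * s"
      by (simp add: torus_map_def s_def)
    have p2: "(cmod (fst (fst (torus_map w))))\<^sup>2 - 17/2 = 15/2 * c"
      unfolding p using c by simp
    have "(15/2 * c)\<^sup>2 + (15/2 * s)\<^sup>2 = 225/4 * (c\<^sup>2 + s\<^sup>2)"
      by (simp add: power_mult_distrib power_divide algebra_simps)
    then have "fst (torus_map w) \<in> genus_surface 1"
      unfolding genus_surface_1_iff p2 z cs by simp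
    then have 1: "torus_map w \<in> genus_surface 1 \<times> ball 0 1"
      using triangle_map_in_ball by (simp add: torus_map_def mem_Times_iff)
    have d: "snd (torus_map w) = triangle_map ((cmod (w $ 1))\<^sup>2) ((cmod (w $ 2))\<^sup>2)"
      by (simp add: torus_map_def)
    have "torus_inv (torus_map w) $ 1 = (cmod (w $ 1) / sqrt (17/2 + 15/2 * c)) *\<^sub>R fst (fst (torus_map w))"
      by (simp add: torus_inv_def p d triangle_inv_map[OF o(1)])
    also have "\<dots> = (cmod (w $ 1) / sqrt (17/2 + 15/2 * c) * (sqrt (17/2 + 15/2 * c) / cmod (w $ 1))) *\<^sub>R w $ 1"
      by (simp only: torus_map_def fst_conv scaleR_scaleR flip: c_def)
    also have "\<dots> = w $ 1"
      using o(4) c by simp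
    finally have 2: "torus_inv (torus_map w) $ 1 = w $ 1" .
    have "torus_inv (torus_map w) $ 2 = (2/15 * cmod (w $ 2)) *\<^sub>R Complex (15/2 * c) (15/2 * s)"
      unfolding torus_inv_def p2 z d triangle_inv_map[OF o(1)] by simp
    also have "\<dots> = w $ 2"
      using o(5) by (simp add: complex_eq_iff c_def s_def)
    finally show ?thesis using 1 2 by (simp add: vec_eq_iff forall_2)
  qed
  show "torus_inv z \<in> ?O \<and> torus_map (torus_inv z) = z" if z: "z \<in> genus_surface 1 \<times> ball 0 1" for z
  proof -
    let ?p = "fst (fst z)" and ?t = "(cmod (fst (fst z)))\<^sup>2 - 17/2" and ?s = "snd (fst z)"
    let ?X = "triangle_inv_X (snd z)" and ?Y = "triangle_inv_Y (snd z)"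
    have "snd z \<in> ball 0 1" using z by auto
    note tr = triangle_inv[OF this]
    have "?p \<noteq> 0" using sub z by blast
    have eq: "?t\<^sup>2 + ?s\<^sup>2 = (15/2)\<^sup>2"
      using z genus_surface_1_iff[of "fst z"] by (auto simp: power_divide)
    have 1: "cmod (torus_inv z $ 1) = sqrt ?X"
      using tr(3) \<open>?p \<noteq> 0\<close> by (simp add: torus_inv_def)
    have "cmod (Complex ?t ?s) = 15/2"
      using eq by (simp add: complex_norm)
    then have 2: "cmod (torus_inv z $ 2) = sqrt ?Y"
      using tr(4) by (simp add: torus_inv_def)
    have "triangle ((cmod (torus_inv z $ 1))\<^sup>2) ((cmod (torus_inv z $ 2))\<^sup>2)"
      using tr by (simp add: 1 2)
    then have mem: "torus_inv z \<in> ?O" by (simp add: coords_triple)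
    have Re: "Re (torus_inv z $ 2) / cmod (torus_inv z $ 2) = 2/15 * ?t"
      and Im: "Im (torus_inv z $ 2) / cmod (torus_inv z $ 2) = 2/15 * ?s"
      unfolding 2 using tr(4) by (simp_all add: torus_inv_def)
    have 3: "17/2 + 15/2 * (2/15 * ?t) = (cmod ?p)\<^sup>2"
      by (simp add: field_simps)
    have "torus_map (torus_inv z) =
        (((sqrt ((cmod ?p)\<^sup>2) / sqrt ?X) *\<^sub>R torus_inv z $ 1, ?s), snd z)"
      unfolding torus_map_def Re Im 3 unfolding 1 2 using tr by simp
    also have "(sqrt ((cmod ?p)\<^sup>2) / sqrt ?X) *\<^sub>R torus_inv z $ 1 = ?p"
      using tr(3) \<open>?p \<noteq> 0\<close> by (simp add: torus_inv_def)
    finally show ?thesis using mem by simp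
  qed
qed

theorem proposition1p14:
  shows "admits_Stein_trisection CP2 1 0"
proof -
  have "openin (top_of CP2) (sector i)" for i
    using openin_sector by (simp add: CP2_def)
  then have "Stein_trisection CP2 1 (\<lambda>_. 0) sector"
    unfolding Stein_trisection_def
    using complex_manifold_CP2 Stein_sector sector_cover diffeomorphic_sector diffeomorphic_pair
      diffeomorphic_triple by (simp add: topspace_CP2)
  then show ?thesis
    unfolding admits_Stein_trisection_def by blast
qed

end
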